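(* Consider the action $S$ on the sphere $S^2$ with parameter $\tau\ge1$. If $\tau\le\sqrt2$, every minimizing measure $\rho$ on $S^2$ is generically timelike, and the minimal action is equal to $4\tau^2-\frac43\tau^4$. If conversely $\tau>\sqrt2$, every minimizing measure $\rho$ is not generically timelike and the interior of $\operatorname{supp}\rho$ is empty.
   Context: Let $F=S^2\subset\mathbb{R}^3$ be the unit sphere and, for a parameter $\tau\ge1$, let $$D(x,y)=2\tau^2\,(1+\langle x,y\rangle)\,\big(2-\tau^2(1-\langle x,y\rangle)\big),\qquad x,y\in F,$$ where $\langle\cdot,\cdot\rangle$ is the Euclidean scalar product, and $L=\max(0,D)$. $\mathfrak{M}$ is the set of all normalized (total mass one) positive regular Borel measures on $F$; $S[\rho]=\iint_{F\times F}L(x,y)\,d\rho(x)\,d\rho(y)$. A minimizing measure (minimizer) is a $\rho\in\mathfrak{M}$ with $S[\rho]=\inf_{\tilde\rho\in\mathfrak{M}}S[\tilde\rho]$; this infimum is the minimal action. A minimizer $\rho$ is called generically timelike if (i) $D(x,y)\ge0$ for all $x,y\in\operatorname{supp}\rho$, and (ii) the function $d(x)=\int_FD(x,y)\,d\rho(y)$ is constant on $F$. *)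

theory Defs
  imports "HOL-Probability.Probability"
begin

abbreviation F :: "(real ^ 3) set" where
  "F \<equiv> sphere 0 1"

definition D :: "real \<Rightarrow> real ^ 3 \<Rightarrow> real ^ 3 \<Rightarrow> real" where
  "D \<tau> x y = 2 * \<tau>\<^sup>2 * (1 + x \<bullet> y) * (2 - \<tau>\<^sup>2 * (1 - x \<bullet> y))"

definition L :: "real \<Rightarrow> real ^ 3 \<Rightarrow> real ^ 3 \<Rightarrow> real" where
  "L \<tau> x y = max 0 (D \<tau> x y)"

text \<open>
  Regularity is relative to the topology of the sphere. For finite Borel measures on
  \<open>F\<close> it holds automatically, see \<open>normalized_measures_eq\<close> below.
\<close>

definition regular :: "(real ^ 3) measure \<Rightarrow> bool" where
  "regular \<rho> \<longleftrightarrow>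
     (\<forall>A \<in> sets \<rho>.
        emeasure \<rho> A = (INF U \<in> {U. openin (top_of_set F) U \<and> A \<subseteq> U}. emeasure \<rho> U) \<and>
        emeasure \<rho> A = (SUP K \<in> {K. compact K \<and> K \<subseteq> A}. emeasure \<rho> K))"

definition normalized_measures :: "(real ^ 3) measure set" where
  "normalized_measures =
     {\<rho>. sets \<rho> = sets (restrict_space borel F) \<and> prob_space \<rho> \<and> regular \<rho>}"

definition action :: "real \<Rightarrow> (real ^ 3) measure \<Rightarrow> real" where
  "action \<tau> \<rho> = (\<integral>x. (\<integral>y. L \<tau> x y \<partial>\<rho>) \<partial>\<rho>)"

text \<open>
  The infimum is over a nonempty set of nonnegative reals, so the real-valued \<open>INF\<close>
  is the genuine infimum.
\<close>

definition minimal_action :: "real \<Rightarrow> real" where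
  "minimal_action \<tau> = (INF \<rho> \<in> normalized_measures. action \<tau> \<rho>)"

definition minimizer :: "real \<Rightarrow> (real ^ 3) measure \<Rightarrow> bool" where
  "minimizer \<tau> \<rho> \<longleftrightarrow> \<rho> \<in> normalized_measures \<and> action \<tau> \<rho> = minimal_action \<tau>"

definition supp :: "(real ^ 3) measure \<Rightarrow> (real ^ 3) set" where
  "supp \<rho> = {x \<in> F. \<forall>U. openin (top_of_set F) U \<and> x \<in> U \<longrightarrow> emeasure \<rho> U > 0}"

definition generically_timelike :: "real \<Rightarrow> (real ^ 3) measure \<Rightarrow> bool" where
  "generically_timelike \<tau> \<rho> \<longleftrightarrow>
     (\<forall>x \<in> supp \<rho>. \<forall>y \<in> supp \<rho>. D \<tau> x y \<ge> 0) \<and>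
     (\<lambda>x. \<integral>y. D \<tau> x y \<partial>\<rho>) constant_on F"

lemma regular_if_finite_borel:
  assumes sets: "sets \<rho> = sets (restrict_space borel F)" and fin: "finite_measure \<rho>"
  shows "regular \<rho>"
proof -
  interpret finite_measure \<rho> by (rule fin)
  define N where "N = distr \<rho> borel id"
  have sp: "space \<rho> = F"
    using sets_eq_imp_space_eq[OF sets] by (simp add: space_restrict_space)
  have meas: "id \<in> measurable \<rho> borel"
    using measurable_restrict_space1[of id borel borel F] measurable_cong_sets[OF sets refl, of borel]
    by auto
  have N: "emeasure N A = emeasure \<rho> (A \<inter> F)" if "A \<in> sets borel" for A
    using that meas by (simp add: N_def emeasure_distr sp)
  have sN: "sets N = sets borel" by (simp add: N_def)
  have finN: "emeasure N (space N) \<noteq> \<infinity>"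
    using N[of UNIV] sp by (simp add: N_def)
  have Fb: "F \<in> sets borel" by simp
  show ?thesis
    unfolding regular_def
  proof (intro ballI conjI)
    fix A assume A: "A \<in> sets \<rho>"
    have AF: "A \<subseteq> F" using A sets.sets_into_space sp by blast
    have Ab: "A \<in> sets borel"
      using A Fb by (auto simp: sets sets_restrict_space)
    have NA: "emeasure N A = emeasure \<rho> A" using N[OF Ab] AF by (simp add: Int_absorb2)
    have opn: "U \<in> sets \<rho>" if "openin (top_of_set F) U" for U
      using that by (auto simp: openin_open sets sets_restrict_space)
    have cmp: "K \<in> sets \<rho>" if "compact K" "K \<subseteq> A" for K
      using that AF by (auto simp: sets sets_restrict_space image_iff intro!: bexI[of _ K] borel_compact)
    show "emeasure \<rho> A = (INF U \<in> {U. openin (top_of_set F) U \<and> A \<subseteq> U}. emeasure \<rho> U)"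
    proof (rule antisym)
      show "emeasure \<rho> A \<le> (INF U \<in> {U. openin (top_of_set F) U \<and> A \<subseteq> U}. emeasure \<rho> U)"
        by (intro INF_greatest emeasure_mono) (auto intro: opn)
      have "(INF U \<in> {U. openin (top_of_set F) U \<and> A \<subseteq> U}. emeasure \<rho> U)
            \<le> (INF U \<in> {U. A \<subseteq> U \<and> open U}. emeasure N U)"
      proof (rule INF_greatest)
        fix U assume U: "U \<in> {U. A \<subseteq> U \<and> open U}"
        have "openin (top_of_set F) (U \<inter> F)" "A \<subseteq> U \<inter> F"
          using U AF by (auto simp: openin_open)
        then have "(INF U \<in> {U. openin (top_of_set F) U \<and> A \<subseteq> U}. emeasure \<rho> U) \<le> emeasure \<rho> (U \<inter> F)"
          by (intro INF_lower) auto
        also have "\<dots> = emeasure N U" using U by (intro N[symmetric]) auto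
        finally show "(INF U \<in> {U. openin (top_of_set F) U \<and> A \<subseteq> U}. emeasure \<rho> U) \<le> emeasure N U" .
      qed
      also have "\<dots> = emeasure \<rho> A"
        using outer_regular[OF sN finN Ab] NA by simp
      finally show "(INF U \<in> {U. openin (top_of_set F) U \<and> A \<subseteq> U}. emeasure \<rho> U) \<le> emeasure \<rho> A" .
    qed
    have "emeasure N A = (SUP K \<in> {K. K \<subseteq> A \<and> compact K}. emeasure N K)"
      by (rule inner_regular[OF sN finN Ab])
    also have "\<dots> = (SUP K \<in> {K. compact K \<and> K \<subseteq> A}. emeasure \<rho> K)"
    proof (rule SUP_cong)
      fix K assume K: "K \<in> {K. compact K \<and> K \<subseteq> A}"
      then have "K \<inter> F = K" using AF by auto
      then show "emeasure N K = emeasure \<rho> K" using N[OF borel_compact, of K] K by simp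
    qed auto
    finally show "emeasure \<rho> A = (SUP K \<in> {K. compact K \<and> K \<subseteq> A}. emeasure \<rho> K)"
      using NA by simp
  qed
qed

lemma normalized_measures_eq:
  "normalized_measures = {\<rho>. sets \<rho> = sets (restrict_space borel F) \<and> prob_space \<rho>}"
  by (auto simp: normalized_measures_def
      intro!: regular_if_finite_borel prob_space.finite_measure)

end

theory Submission
  imports Defs
begin

text \<open>
  Writing \<open>t\<close> for the scalar product, \<open>D = 2\<tau>\<^sup>2(2 - \<tau>\<^sup>2) + 4\<tau>\<^sup>2t + 2\<tau>\<^sup>4t\<^sup>2\<close>, so the double integral of \<open>D\<close>
  equals \<open>4\<tau>\<^sup>2 - 4\<tau>\<^sup>4/3\<close> plus a sum of squares in the first moments and the trace-free second
  moments. As \<open>L \<ge> D\<close>, this bounds the action from below; for \<open>\<tau>\<^sup>2 \<le> 2\<close> the uniform measure on the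
  vertices of an octahedron attains the bound, and equality forces generic timelikeness.

  For \<open>\<tau>\<^sup>2 > 2\<close> the light cone lies at \<open>t = c\<close> with \<open>c = 1 - 2/\<tau>\<^sup>2 > 0\<close>, which excludes vanishing first
  and isotropic second moments. If \<open>x\<close> were interior to the support of a minimizer, then no point \<open>y\<close> of
  the support could lie on the light cone of \<open>x\<close>: the Gram matrix of \<open>L\<close> on points of the support is
  positive semidefinite, but a second difference at \<open>x\<close> in the direction of \<open>y\<close> sees the kink of \<open>L\<close> to
  first order in the step size \<open>h\<close>, while its self-energy is only of order \<open>h\<^sup>4\<close>. Hence near \<open>x\<close> the potential,
  which is constant on the support, is the integral of \<open>D\<close> over the fixed set of \<open>y\<close> with \<open>t > c\<close>. Constancy of
  this quadratic polynomial along arcs through \<open>x\<close> makes the integral of \<open>t\<close> over that set vanish,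
  although \<open>t > c > 0\<close> there.
\<close>

section \<open>The kernel as a function of the scalar product: bounds and continuity\<close>

definition prof :: "real \<Rightarrow> real \<Rightarrow> real" where
  "prof \<tau> t = 2 * \<tau>\<^sup>2 * (1 + t) * (2 - \<tau>\<^sup>2 * (1 - t))"

lemma D_eq_prof: "D \<tau> x y = prof \<tau> (x \<bullet> y)"
  by (simp add: D_def prof_def)

lemma D_expand:
  "D \<tau> x y = 2 * \<tau>\<^sup>2 * (2 - \<tau>\<^sup>2) + 4 * \<tau>\<^sup>2 * (x \<bullet> y) + 2 * \<tau> ^ 4 * (x \<bullet> y)\<^sup>2"
  by (simp add: D_def algebra_simps power2_eq_square power4_eq_xxxx)

text \<open>The derivative of \<open>prof \<tau>\<close> is
  \<open>4 * \<tau>\<^sup>2 * (1 + \<tau>\<^sup>2 * t)\<close>, and the constant is the maximum of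
  its absolute value on \<open>[-1, 1]\<close>, attained at \<open>t = 1\<close>. Factoring the
  difference gives the bound directly.\<close>

lemma prof_Lipschitz:
  assumes "\<bar>s\<bar> \<le> 1" "\<bar>t\<bar> \<le> 1"
  shows "\<bar>prof \<tau> s - prof \<tau> t\<bar> \<le> 4 * \<tau>\<^sup>2 * (1 + \<tau>\<^sup>2) * \<bar>s - t\<bar>"
proof -
  have "\<bar>2 + \<tau>\<^sup>2 * (s + t)\<bar> \<le> 2 + \<tau>\<^sup>2 * 2"
  proof -
    have "\<bar>\<tau>\<^sup>2 * (s + t)\<bar> \<le> \<tau>\<^sup>2 * 2"
      unfolding abs_mult using assms by (intro mult_mono) auto
    then show ?thesis by linarith
  qed
  then have "2 * \<tau>\<^sup>2 * \<bar>s - t\<bar> * \<bar>2 + \<tau>\<^sup>2 * (s + t)\<bar> \<le> 2 * \<tau>\<^sup>2 * \<bar>s - t\<bar> * (2 + \<tau>\<^sup>2 * 2)"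
    by (intro mult_left_mono) auto
  moreover have "prof \<tau> s - prof \<tau> t = 2 * \<tau>\<^sup>2 * (s - t) * (2 + \<tau>\<^sup>2 * (s + t))"
    by (simp add: prof_def algebra_simps power2_eq_square)
  ultimately have "\<bar>prof \<tau> s - prof \<tau> t\<bar> \<le> 2 * \<tau>\<^sup>2 * \<bar>s - t\<bar> * (2 + \<tau>\<^sup>2 * 2)"
    by (simp add: abs_mult)
  then show ?thesis
    by (simp add: algebra_simps)
qed

text \<open>Between unit vectors the scalar product is 1-Lipschitz in each argument, and
  \<open>max 0\<close> does not increase differences, so the constant of
  \<open>prof_Lipschitz\<close> carries over.\<close>

lemma L_Lipschitz:
  assumes "x \<in> F" "x' \<in> F" "y \<in> F" "y' \<in> F"
  shows "\<bar>L \<tau> x y - L \<tau> x' y'\<bar> \<le> 4 * \<tau>\<^sup>2 * (1 + \<tau>\<^sup>2) * (dist x x' + dist y y')"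
proof -
  have b: "\<bar>u \<bullet> v\<bar> \<le> 1" if "u \<in> F" "v \<in> F" for u v :: "real^3"
    using Cauchy_Schwarz_ineq2[of u v] that by simp
  have "x \<bullet> y - x' \<bullet> y' = (x - x') \<bullet> y + x' \<bullet> (y - y')"
    by (simp add: inner_diff_left inner_diff_right)
  moreover have "\<bar>(x - x') \<bullet> y\<bar> \<le> dist x x'" "\<bar>x' \<bullet> (y - y')\<bar> \<le> dist y y'"
    using Cauchy_Schwarz_ineq2[of "x - x'" y] Cauchy_Schwarz_ineq2[of x' "y - y'"] assms
    by (auto simp: dist_norm)
  ultimately have "\<bar>x \<bullet> y - x' \<bullet> y'\<bar> \<le> dist x x' + dist y y'" by linarith
  then have "4 * \<tau>\<^sup>2 * (1 + \<tau>\<^sup>2) * \<bar>x \<bullet> y - x' \<bullet> y'\<bar> \<le> 4 * \<tau>\<^sup>2 * (1 + \<tau>\<^sup>2) * (dist x x' + dist y y')"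
    by (intro mult_left_mono) auto
  moreover have "\<bar>L \<tau> x y - L \<tau> x' y'\<bar> \<le> \<bar>D \<tau> x y - D \<tau> x' y'\<bar>"
    by (auto simp: L_def max_def)
  moreover have "\<bar>D \<tau> x y - D \<tau> x' y'\<bar> \<le> 4 * \<tau>\<^sup>2 * (1 + \<tau>\<^sup>2) * \<bar>x \<bullet> y - x' \<bullet> y'\<bar>"
    unfolding D_eq_prof using assms by (intro prof_Lipschitz b)
  ultimately show ?thesis by linarith
qed

lemma L_commute: "L \<tau> x y = L \<tau> y x"
  by (simp add: D_def L_def inner_commute)

lemma continuous_on_D [continuous_intros]:
  "continuous_on A f \<Longrightarrow> continuous_on A g \<Longrightarrow> continuous_on A (\<lambda>x. D \<tau> (f x) (g x))"
  unfolding D_def by (intro continuous_intros)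

lemma continuous_on_L [continuous_intros]:
  "continuous_on A f \<Longrightarrow> continuous_on A g \<Longrightarrow> continuous_on A (\<lambda>x. L \<tau> (f x) (g x))"
  unfolding L_def by (intro continuous_intros)

text \<open>The energy is bilinear in the density. Fubini and the symmetry of \<open>k\<close>
  identify the two mixed terms, hence the factor \<open>2 * t\<close>; boundedness supplies
  integrability throughout. The coefficients of \<open>t\<close> and \<open>t\<^sup>2\<close> become
  the first and second variation of the action.\<close>

lemma (in prob_space) energy_expand:
  fixes k :: "'a \<Rightarrow> 'a \<Rightarrow> real" and f :: "'a \<Rightarrow> real"
  assumes k [measurable]: "(\<lambda>(x, y). k x y) \<in> borel_measurable (M \<Otimes>\<^sub>M M)"
    and f [measurable]: "f \<in> borel_measurable M"
    and bound: "\<And>x y. x \<in> space M \<Longrightarrow> y \<in> space M \<Longrightarrow> \<bar>k x y\<bar> \<le> C"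
    and sym: "\<And>x y. k x y = k y x"
    and f_bound: "\<And>x. x \<in> space M \<Longrightarrow> \<bar>f x\<bar> \<le> B"
  shows "(\<integral>x. (1 + t * f x) * (\<integral>y. (1 + t * f y) * k x y \<partial>M) \<partial>M) =
           (\<integral>x. (\<integral>y. k x y \<partial>M) \<partial>M) + 2 * t * (\<integral>x. f x * (\<integral>y. k x y \<partial>M) \<partial>M)
            + t\<^sup>2 * (\<integral>x. f x * (\<integral>y. f y * k x y \<partial>M) \<partial>M)"
proof -
  interpret P: pair_prob_space M M ..
  obtain z where z: "z \<in> space M" using not_empty by auto
  have C0: "0 \<le> C" and B0: "0 \<le> B" using bound[OF z z] f_bound[OF z] by linarith+
  define l where "l x = (\<integral>y. k x y \<partial>M)" for x
  define m where "m x = (\<integral>y. f y * k x y \<partial>M)" for x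
  have [measurable]: "l \<in> borel_measurable M" "m \<in> borel_measurable M"
    unfolding l_def m_def by measurable
  have ik: "integrable M (k x)" if "x \<in> space M" for x
    using that bound by (intro integrable_const_bound[of _ C]) (auto)
  have ifk: "integrable M (\<lambda>y. f y * k x y)" if "x \<in> space M" for x
    using that bound f_bound C0 B0
    by (intro integrable_const_bound[of _ "B * C"]) (auto simp: abs_mult intro!: mult_mono)
  have ibd: "integrable M g" if "g \<in> borel_measurable M" "\<And>x. x \<in> space M \<Longrightarrow> \<bar>g x\<bar> \<le> b" for g :: "'a \<Rightarrow> real" and b
    using that by (intro integrable_const_bound[of _ b]) auto
  have lb: "\<bar>l x\<bar> \<le> C" if "x \<in> space M" for x
  proof -
    have "norm (l x) \<le> (\<integral>y. norm (k x y) \<partial>M)" unfolding l_def by (rule integral_norm_bound)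
    also have "\<dots> \<le> (\<integral>y. C \<partial>M)" using ik[OF that] bound that by (intro integral_mono) auto
    finally show ?thesis by (simp add: prob_space)
  qed
  have mb: "\<bar>m x\<bar> \<le> B * C" if "x \<in> space M" for x
  proof -
    have "norm (m x) \<le> (\<integral>y. norm (f y * k x y) \<partial>M)" unfolding m_def by (rule integral_norm_bound)
    also have "\<dots> \<le> (\<integral>y. B * C \<partial>M)" using bound f_bound that C0 B0
      by (intro integral_mono integrable_norm ifk integrable_const) (auto simp: abs_mult intro!: mult_mono)
    finally show ?thesis by (simp add: prob_space)
  qed
  have il: "integrable M l" using lb by (intro ibd[of _ C]) auto
  have im: "integrable M m" using mb by (intro ibd[of _ "B * C"]) auto
  have ifl: "integrable M (\<lambda>x. f x * l x)"
    using lb f_bound C0 B0 by (intro ibd[of _ "B * C"]) (auto simp: abs_mult intro!: mult_mono)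
  have ifm: "integrable M (\<lambda>x. f x * m x)"
    using mb f_bound C0 B0 by (intro ibd[of _ "B * (B * C)"]) (auto simp: abs_mult intro!: mult_mono)
  have inner: "(\<integral>y. (1 + t * f y) * k x y \<partial>M) = l x + t * m x" if "x \<in> space M" for x
  proof -
    have "(\<integral>y. (1 + t * f y) * k x y \<partial>M) = (\<integral>y. k x y + t * (f y * k x y) \<partial>M)"
      by (simp add: algebra_simps)
    then show ?thesis using ik[OF that] ifk[OF that] by (simp add: l_def m_def)
  qed
  have "(\<integral>x. (1 + t * f x) * (\<integral>y. (1 + t * f y) * k x y \<partial>M) \<partial>M)
      = (\<integral>x. (l x + t * m x) + t * (f x * l x + t * (f x * m x)) \<partial>M)"
    by (intro Bochner_Integration.integral_cong refl) (simp only: inner, simp add: algebra_simps)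
  also have "\<dots> = (\<integral>x. l x \<partial>M) + t * (\<integral>x. m x \<partial>M) + t * ((\<integral>x. f x * l x \<partial>M) + t * (\<integral>x. f x * m x \<partial>M))"
    using il im ifl ifm by simp
  also have "(\<integral>x. m x \<partial>M) = (\<integral>x. f x * l x \<partial>M)"
  proof -
    have "integrable (M \<Otimes>\<^sub>M M) (\<lambda>(x, y). f y * k x y)"
      using bound f_bound C0 B0
      by (intro P.integrable_const_bound[of _ "B * C"])
        (auto simp: abs_mult space_pair_measure intro!: mult_mono AE_I2)
    from P.Fubini_integral[OF this]
    have "(\<integral>x. m x \<partial>M) = (\<integral>y. (\<integral>x. f y * k x y \<partial>M) \<partial>M)" by (simp add: m_def)
    also have "\<dots> = (\<integral>y. f y * l y \<partial>M)"
      by (simp add: l_def sym)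
    finally show ?thesis .
  qed
  finally show ?thesis by (simp add: l_def m_def algebra_simps power2_eq_square)
qed

text \<open>\<open>L\<close> vanishes at the antipodal pair \<open>x\<close>, \<open>- x\<close>,
  and the sphere has diameter 2, so the Lipschitz bound in the second argument suffices.\<close>

lemma L_bound:
  assumes "x \<in> F" "y \<in> F"
  shows "\<bar>L \<tau> x y\<bar> \<le> 4 * \<tau>\<^sup>2 * (1 + \<tau>\<^sup>2) * 2"
proof -
  have "L \<tau> x (- x) = 0" using assms by (simp add: L_def D_def dot_square_norm)
  moreover have "- x \<in> F" using assms by simp
  ultimately have "\<bar>L \<tau> x y\<bar> \<le> 4 * \<tau>\<^sup>2 * (1 + \<tau>\<^sup>2) * dist y (- x)"
    using L_Lipschitz[of x x y "- x" \<tau>] assms by simp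
  also have "\<dots> \<le> 4 * \<tau>\<^sup>2 * (1 + \<tau>\<^sup>2) * 2"
    using assms norm_triangle_ineq[of y x] by (intro mult_left_mono) (auto simp: dist_norm)
  finally show ?thesis .
qed

section \<open>Probability measures on the sphere, their supports and potentials\<close>

locale sphere_prob = prob_space \<rho> for \<rho> :: "(real ^ 3) measure" +
  assumes sets_rho: "sets \<rho> = sets (restrict_space borel F)"
begin

lemma space_rho [simp]: "space \<rho> = F"
  using sets_eq_imp_space_eq[OF sets_rho] by (simp add: space_restrict_space)

lemma prob_F [simp]: "prob F = 1"
  using prob_space by simp

lemma measurable_of_borel: "g \<in> borel_measurable borel \<Longrightarrow> g \<in> borel_measurable \<rho>"
  unfolding measurable_cong_sets[OF sets_rho refl] by (rule measurable_restrict_space1)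

lemma measurable_continuous_on_F:
  "continuous_on F g \<Longrightarrow> g \<in> borel_measurable \<rho>"
  unfolding measurable_cong_sets[OF sets_rho refl] by (rule borel_measurable_continuous_on_restrict)

lemma bounded_continuous_on_F:
  fixes g :: "real ^ 3 \<Rightarrow> real"
  assumes "continuous_on F g"
  obtains B where "B > 0" "\<And>x. x \<in> F \<Longrightarrow> \<bar>g x\<bar> \<le> B"
proof -
  have "bounded (g ` F)"
    using assms by (intro compact_imp_bounded compact_continuous_image) auto
  then obtain B where "\<forall>x\<in>g ` F. norm x \<le> B" unfolding bounded_iff by auto
  then show thesis by (intro that[of "max B 1"]) (auto intro: max.coboundedI1)
qed

lemma integrable_continuous_on_F:
  fixes g :: "real ^ 3 \<Rightarrow> real"
  assumes "continuous_on F g"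
  shows "integrable \<rho> g"
proof -
  obtain B where "\<And>x. x \<in> F \<Longrightarrow> \<bar>g x\<bar> \<le> B" using bounded_continuous_on_F[OF assms] by blast
  then show ?thesis
    using assms by (intro integrable_const_bound[of _ B] measurable_continuous_on_F) auto
qed

lemma openin_sets:
  assumes "openin (top_of_set F) U"
  shows "U \<in> sets \<rho>"
proof -
  from assms obtain T where T: "open T" "U = F \<inter> T" unfolding openin_open by blast
  have "T \<in> sets borel" using T(1) by (rule borel_open)
  then show ?thesis unfolding sets_rho sets_restrict_space T(2) by (rule imageI)
qed

lemma supp_subset: "supp \<rho> \<subseteq> F"
  by (auto simp: supp_def)

text \<open>The complement of the support is a union of relatively open null sets. By the Lindelof
  property countably many of them already cover it, so it is a null set.\<close>

lemma AE_supp: "AE x in \<rho>. x \<in> supp \<rho>"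
proof -
  define N where "N = {U. openin (top_of_set F) U \<and> emeasure \<rho> U = 0}"
  obtain N' where N': "N' \<subseteq> N" "countable N'" "\<Union>N' = \<Union>N"
    using Lindelof_openin[of N F] by (auto simp: N_def)
  have "(\<Union>U\<in>N'. U) \<in> null_sets \<rho>"
    using N' openin_sets by (intro null_sets_UN') (auto simp: N_def null_sets_def)
  then have "\<Union>N \<in> null_sets \<rho>" using N' by simp
  moreover have "{x \<in> space \<rho>. x \<notin> supp \<rho>} \<subseteq> \<Union>N"
    by (auto simp: supp_def N_def)
  ultimately show ?thesis by (rule AE_I')
qed

lemma supp_nonempty: "supp \<rho> \<noteq> {}"
  using AE_supp by auto

lemma measure_pos_if_supp:
  assumes "x \<in> supp \<rho>" "openin (top_of_set F) U" "x \<in> U"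
  shows "measure \<rho> U > 0"
  using assms by (auto simp: supp_def emeasure_eq_measure)

text \<open>A nonnegative function with integral 0 vanishes almost everywhere. By continuity the set
  where it does not vanish is open, and an open null set misses the support.\<close>

lemma zero_on_supp_if_integral_zero:
  fixes g :: "real ^ 3 \<Rightarrow> real"
  assumes cont: "continuous_on F g" and nonneg: "\<And>x. x \<in> F \<Longrightarrow> 0 \<le> g x"
    and zero: "(\<integral>x. g x \<partial>\<rho>) = 0" and x: "x \<in> supp \<rho>"
  shows "g x = 0"
proof (rule ccontr)
  assume "g x \<noteq> 0"
  then have pos: "g x > 0" using nonneg[of x] x supp_subset by (force simp: less_le)
  have "AE y in \<rho>. g y = 0"
    using integral_nonneg_eq_0_iff_AE[OF integrable_continuous_on_F[OF cont]] AE_I2[of \<rho> "\<lambda>x. 0 \<le> g x"]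
      nonneg zero by simp
  then have ae: "AE y in \<rho>. y \<notin> {y \<in> F. g y \<noteq> 0}" by auto
  have "openin (top_of_set F) (F \<inter> g -` (- {0}))"
    using cont by (intro continuous_openin_preimage_gen) auto
  moreover have "F \<inter> g -` (- {0}) = {y \<in> F. g y \<noteq> 0}" by auto
  ultimately have op: "openin (top_of_set F) {y \<in> F. g y \<noteq> 0}" by simp
  have "measure \<rho> {y \<in> F. g y \<noteq> 0} > 0"
    using pos x supp_subset by (intro measure_pos_if_supp[OF x op]) auto
  moreover have "measure \<rho> {y \<in> F. g y \<noteq> 0} = 0"
    using ae openin_sets[OF op] by (simp add: measure_eq_0_null_sets AE_iff_null_sets)
  ultimately show False by simp
qed

lemma measurable_inner_kernel:
  fixes h :: "real \<Rightarrow> real"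
  assumes h: "h \<in> borel_measurable borel"
  shows "(\<lambda>(x, y). h (x \<bullet> y)) \<in> borel_measurable (\<rho> \<Otimes>\<^sub>M \<rho>)"
proof -
  have id: "(\<lambda>x. x) \<in> borel_measurable \<rho>" by (rule measurable_of_borel) simp
  have fs: "fst \<in> borel_measurable (\<rho> \<Otimes>\<^sub>M \<rho>)" "snd \<in> borel_measurable (\<rho> \<Otimes>\<^sub>M \<rho>)"
    using measurable_compose[OF measurable_fst id] measurable_compose[OF measurable_snd id] by this+
  show ?thesis
    using measurable_compose[OF borel_measurable_inner[OF fs] h] by (simp only: case_prod_unfold)
qed

lemma measurable_L: "(\<lambda>(x, y). L \<tau> x y) \<in> borel_measurable (\<rho> \<Otimes>\<^sub>M \<rho>)"
proof -
  have "(\<lambda>t. max 0 (prof \<tau> t)) \<in> borel_measurable borel"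
    unfolding prof_def by (intro borel_measurable_continuous_onI continuous_intros)
  from measurable_inner_kernel[OF this] show ?thesis
    unfolding L_def D_eq_prof .
qed

definition potential :: "real \<Rightarrow> real ^ 3 \<Rightarrow> real" where
  "potential \<tau> x = (\<integral>y. L \<tau> x y \<partial>\<rho>)"

lemma integral_potential: "(\<integral>x. potential \<tau> x \<partial>\<rho>) = action \<tau> \<rho>"
  by (simp add: potential_def action_def)

lemma integrable_L: "integrable \<rho> (L \<tau> x)"
proof -
  have "continuous_on F (\<lambda>y. L \<tau> x y)" by (intro continuous_intros)
  then show ?thesis by (rule integrable_continuous_on_F)
qed

lemma potential_Lipschitz:
  assumes "x \<in> F" "x' \<in> F"
  shows "\<bar>potential \<tau> x - potential \<tau> x'\<bar> \<le> 4 * \<tau>\<^sup>2 * (1 + \<tau>\<^sup>2) * dist x x'"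
proof -
  have "\<bar>potential \<tau> x - potential \<tau> x'\<bar> = \<bar>(\<integral>y. L \<tau> x y - L \<tau> x' y \<partial>\<rho>)\<bar>"
    unfolding potential_def using assms integrable_L by simp
  also have "\<dots> \<le> (\<integral>y. \<bar>L \<tau> x y - L \<tau> x' y\<bar> \<partial>\<rho>)"
    by (rule integral_abs_bound)
  also have "\<dots> \<le> (\<integral>y. 4 * \<tau>\<^sup>2 * (1 + \<tau>\<^sup>2) * dist x x' \<partial>\<rho>)"
    using assms L_Lipschitz[OF assms, of y y for y]
    by (intro integral_mono integrable_abs Bochner_Integration.integrable_diff integrable_L integrable_const) force+
  finally show ?thesis by simp
qed

lemma continuous_on_potential: "continuous_on F (potential \<tau>)"
proof -
  have "(4 * \<tau>\<^sup>2 * (1 + \<tau>\<^sup>2))-lipschitz_on F (potential \<tau>)"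
  proof (rule lipschitz_onI)
    show "dist (potential \<tau> x) (potential \<tau> y) \<le> 4 * \<tau>\<^sup>2 * (1 + \<tau>\<^sup>2) * dist x y"
      if "x \<in> F" "y \<in> F" for x y
      unfolding dist_real_def using that by (rule potential_Lipschitz)
  qed simp
  then show ?thesis by (rule lipschitz_on_continuous_on)
qed

end

section \<open>First and second variation of the action at a minimizer\<close>

lemma quadratic_nonneg_near_zero:
  fixes p q r :: real
  assumes r: "r > 0" and nonneg: "\<And>t. \<bar>t\<bar> \<le> r \<Longrightarrow> 0 \<le> 2 * t * p + t\<^sup>2 * q"
  shows "p = 0" and "q \<ge> 0"
proof -
  show p0: "p = 0"
  proof (rule ccontr)
    assume "p \<noteq> 0"
    \<comment> \<open>This choice gives \<open>s * q \<le> \<bar>p\<bar>\<close>, so at the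
      parameter \<open>- sgn p * s\<close> the negative linear term outweighs the quadratic
      one.\<close>
    define s where "s = min r (\<bar>p\<bar> / (\<bar>q\<bar> + 1))"
    have s: "s > 0" "s \<le> r" using r \<open>p \<noteq> 0\<close> by (auto simp: s_def)
    have "s \<le> \<bar>p\<bar> / (\<bar>q\<bar> + 1)" by (simp add: s_def)
    then have "s * (\<bar>q\<bar> + 1) \<le> \<bar>p\<bar>" by (simp add: pos_le_divide_eq)
    moreover have "s * q \<le> s * (\<bar>q\<bar> + 1)" using s by (intro mult_left_mono) auto
    ultimately have "s * q \<le> \<bar>p\<bar>" by linarith
    then have "s * (s * q) \<le> s * \<bar>p\<bar>" using s by (intro mult_left_mono) auto
    moreover have "0 \<le> 2 * (- sgn p * s) * p + (- sgn p * s)\<^sup>2 * q"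
      using s by (intro nonneg) (auto simp: abs_mult abs_sgn_eq)
    moreover have "2 * (- sgn p * s) * p + (- sgn p * s)\<^sup>2 * q = - 2 * (s * \<bar>p\<bar>) + s * (s * q)"
      using \<open>p \<noteq> 0\<close> by (auto simp: sgn_if power2_eq_square)
    moreover have "s * \<bar>p\<bar> > 0" using s \<open>p \<noteq> 0\<close> by simp
    ultimately show False by linarith
  qed
  have "0 \<le> r\<^sup>2 * q" using nonneg[of r] r p0 by simp
  then show "q \<ge> 0" using r by (simp add: zero_le_mult_iff)
qed

context sphere_prob
begin

lemma F_sets [simp]: "F \<in> sets \<rho>"
  using sets.top[of \<rho>] by simp

lemma measurable_inner_integral:
  assumes w: "w \<in> borel_measurable \<rho>"
  shows "(\<lambda>x. \<integral>y. w y * L \<tau> x y \<partial>\<rho>) \<in> borel_measurable \<rho>"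
proof -
  note [measurable] = w measurable_L[of \<tau>]
  show ?thesis by measurable
qed

text \<open>If the total weight is positive, the normalized density \<open>w / a\<close> defines a
  competitor, whose action is the right-hand side divided by \<open>a\<^sup>2\<close>. Multiplying
  out makes the inequality homogeneous in \<open>w\<close>, and for total weight 0 it reduces to
  \<open>L \<ge> 0\<close>.\<close>

lemma minimizer_weight_ineq:
  assumes min: "minimizer \<tau> \<rho>" and w: "w \<in> borel_measurable \<rho>"
    and bound: "\<And>x. x \<in> F \<Longrightarrow> 0 \<le> w x \<and> w x \<le> B"
  shows "action \<tau> \<rho> * (\<integral>x. w x \<partial>\<rho>)\<^sup>2 \<le> (\<integral>x. w x * (\<integral>y. w y * L \<tau> x y \<partial>\<rho>) \<partial>\<rho>)"
proof (cases "(\<integral>x. w x \<partial>\<rho>) = 0")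
  case True
  have "0 \<le> (\<integral>x. w x * (\<integral>y. w y * L \<tau> x y \<partial>\<rho>) \<partial>\<rho>)"
    using bound by (intro Bochner_Integration.integral_nonneg mult_nonneg_nonneg) (auto simp: L_def)
  then show ?thesis using True by simp
next
  case False
  define a where "a = (\<integral>x. w x \<partial>\<rho>)"
  have "0 \<le> a" unfolding a_def using bound by (intro Bochner_Integration.integral_nonneg) auto
  with False have a: "a > 0" by (simp add: a_def)
  have iw: "integrable \<rho> w"
    using bound w by (intro integrable_const_bound[of _ B]) auto
  define N where "N = density \<rho> (\<lambda>x. ennreal (w x / a))"
  have wa: "(\<lambda>x. w x / a) \<in> borel_measurable \<rho>" using w by simp
  have wa0: "AE x in \<rho>. 0 \<le> w x / a" using bound a by (intro AE_I2) auto
  have sN: "sets N = sets (restrict_space borel F)" by (simp add: N_def sets_rho)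
  have "emeasure N (space N) = (\<integral>\<^sup>+x. ennreal (w x / a) \<partial>\<rho>)"
    unfolding N_def using wa by (subst emeasure_density) (auto simp: nn_integral_indicator intro!: nn_integral_cong)
  also have "\<dots> = ennreal (\<integral>x. w x / a \<partial>\<rho>)"
    using iw wa0 by (intro nn_integral_eq_integral) auto
  also have "\<dots> = 1" using a by (simp add: a_def[symmetric])
  finally have "prob_space N" by (rule prob_spaceI)
  then have "N \<in> normalized_measures" using sN by (simp add: normalized_measures_eq)
  moreover have "bdd_below (action \<tau> ` normalized_measures)"
    by (intro bdd_belowI[of _ 0])
      (auto simp: action_def L_def intro!: Bochner_Integration.integral_nonneg)
  ultimately have "action \<tau> \<rho> \<le> action \<tau> N"
    using min by (auto simp: minimizer_def minimal_action_def intro!: cINF_lower)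
  also have dens: "(\<integral>x. g x \<partial>N) = (\<integral>x. w x / a * g x \<partial>\<rho>)" if "g \<in> borel_measurable \<rho>" for g :: "real^3 \<Rightarrow> real"
    unfolding N_def using integral_density[OF that wa wa0] by simp
  have "action \<tau> N = (\<integral>x. (\<integral>y. w y * L \<tau> x y \<partial>\<rho>) / a \<partial>N)"
    unfolding action_def
    by (intro Bochner_Integration.integral_cong refl, subst dens)
      (auto intro!: borel_measurable_integrable[OF integrable_L])
  also have "\<dots> = (\<integral>x. w x * (\<integral>y. w y * L \<tau> x y \<partial>\<rho>) \<partial>\<rho>) / a\<^sup>2"
    using measurable_inner_integral[OF w, of \<tau>] by (subst dens) (auto simp: power2_eq_square)
  finally show ?thesis using a by (simp add: pos_le_divide_eq a_def)
qed

text \<open>Apply \<open>minimizer_weight_ineq\<close> to the weights \<open>1 + t * g\<close> for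
  small \<open>t\<close> of either sign: the two sides differ by
  \<open>2 * t * p + t\<^sup>2 * q\<close>. Thus \<open>p = 0\<close>, the Euler-Lagrange equation,
  and \<open>q \<ge> 0\<close>, the second variation.\<close>

lemma minimizer_variation:
  assumes min: "minimizer \<tau> \<rho>" and g: "g \<in> borel_measurable \<rho>"
    and bound: "\<And>x. x \<in> F \<Longrightarrow> \<bar>g x\<bar> \<le> B"
  shows "(\<integral>x. g x * potential \<tau> x \<partial>\<rho>) = action \<tau> \<rho> * (\<integral>x. g x \<partial>\<rho>)" (is ?A)
    and "action \<tau> \<rho> * (\<integral>x. g x \<partial>\<rho>)\<^sup>2 \<le> (\<integral>x. g x * (\<integral>y. g y * L \<tau> x y \<partial>\<rho>) \<partial>\<rho>)" (is ?B)
proof -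
  \<comment> \<open>For \<open>\<bar>t\<bar> \<le> r\<close> the perturbation satisfies
    \<open>\<bar>t * g x\<bar> \<le> 1\<close>, so the weight \<open>1 + t * g x\<close> lies
    between 0 and 2.\<close>
  define r where "r = 1 / (\<bar>B\<bar> + 1)"
  define a where "a = (\<integral>x. g x \<partial>\<rho>)"
  define p where "p = (\<integral>x. g x * potential \<tau> x \<partial>\<rho>) - action \<tau> \<rho> * a"
  define q where "q = (\<integral>x. g x * (\<integral>y. g y * L \<tau> x y \<partial>\<rho>) \<partial>\<rho>) - action \<tau> \<rho> * a\<^sup>2"
  have r: "r > 0" by (simp add: r_def)
  have ig: "integrable \<rho> g" using g bound by (intro integrable_const_bound[of _ B]) auto
  have "0 \<le> 2 * t * p + t\<^sup>2 * q" if t: "\<bar>t\<bar> \<le> r" for t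
  proof -
    have tg: "\<bar>t * g x\<bar> \<le> 1" if "x \<in> F" for x
    proof -
      have "\<bar>t * g x\<bar> \<le> r * (\<bar>B\<bar> + 1)"
        unfolding abs_mult using t bound[OF that] r by (intro mult_mono) auto
      moreover have "r * (\<bar>B\<bar> + 1) = 1" by (simp add: r_def add_nonneg_eq_0_iff)
      ultimately show ?thesis by simp
    qed
    have w: "(\<lambda>x. 1 + t * g x) \<in> borel_measurable \<rho>" using g by simp
    have "0 \<le> 1 + t * g x \<and> 1 + t * g x \<le> 2" if "x \<in> F" for x
      using tg[OF that] by linarith
    note minimizer_weight_ineq[OF min w this]
    moreover have "(\<integral>x. 1 + t * g x \<partial>\<rho>) = 1 + t * a" using ig by (simp add: a_def)
    moreover have "(\<integral>x. (1 + t * g x) * (\<integral>y. (1 + t * g y) * L \<tau> x y \<partial>\<rho>) \<partial>\<rho>)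
        = action \<tau> \<rho> + 2 * t * (\<integral>x. g x * potential \<tau> x \<partial>\<rho>)
          + t\<^sup>2 * (\<integral>x. g x * (\<integral>y. g y * L \<tau> x y \<partial>\<rho>) \<partial>\<rho>)"
      unfolding action_def potential_def
      using bound L_bound by (intro energy_expand[OF measurable_L g _ L_commute]) (simp_all only: space_rho)
    ultimately show ?thesis
      by (simp add: p_def q_def power2_eq_square algebra_simps)
  qed
  from quadratic_nonneg_near_zero[OF r this] show ?A ?B
    by (simp_all add: p_def q_def a_def)
qed

text \<open>Test the first variation with the deviation \<open>g\<close> of the potential from the
  action itself: the integral of \<open>g\<^sup>2\<close> is then 0, and \<open>g\<close> is
  continuous.\<close>

lemma potential_on_supp:
  assumes min: "minimizer \<tau> \<rho>" and x: "x \<in> supp \<rho>"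
  shows "potential \<tau> x = action \<tau> \<rho>"
proof -
  let ?S = "action \<tau> \<rho>"
  define g where "g x = potential \<tau> x - ?S" for x
  have cont: "continuous_on F g" unfolding g_def by (intro continuous_intros continuous_on_potential)
  have int: "integrable \<rho> (potential \<tau>)" "integrable \<rho> g" "integrable \<rho> (\<lambda>x. g x * potential \<tau> x)"
    using cont continuous_on_potential
    by (auto intro!: integrable_continuous_on_F continuous_on_mult)
  obtain B where B: "\<And>x. x \<in> F \<Longrightarrow> \<bar>g x\<bar> \<le> B" using bounded_continuous_on_F[OF cont] by blast
  have "(\<integral>x. (g x)\<^sup>2 \<partial>\<rho>) = (\<integral>x. g x * potential \<tau> x - ?S * g x \<partial>\<rho>)"
    by (simp add: g_def power2_eq_square algebra_simps)
  also have "\<dots> = 0"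
    using minimizer_variation(1)[OF min measurable_continuous_on_F[OF cont] B] int by simp
  finally have "(g x)\<^sup>2 = 0"
    using cont x by (intro zero_on_supp_if_integral_zero[of "\<lambda>x. (g x)\<^sup>2"] continuous_on_power) auto
  then show ?thesis by (simp add: g_def)
qed

lemma action_nonneg: "0 \<le> action \<tau> \<rho>"
  unfolding action_def L_def by (intro Bochner_Integration.integral_nonneg) auto

text \<open>The second variation admits bounded densities only, so the point masses are replaced by
  normalized indicators of small balls around the points. These balls have positive mass because the
  points lie in the support, and the Lipschitz bound on \<open>L\<close> controls the error.\<close>

lemma minimizer_Gram_nonneg:
  fixes p :: "'i \<Rightarrow> real ^ 3" and a :: "'i \<Rightarrow> real"
  assumes min: "minimizer \<tau> \<rho>" and fin: "finite I" and p: "\<And>i. i \<in> I \<Longrightarrow> p i \<in> supp \<rho>"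
  shows "0 \<le> (\<Sum>i\<in>I. \<Sum>j\<in>I. a i * a j * L \<tau> (p i) (p j))"
proof (rule field_le_epsilon)
  fix e :: real assume e: "e > 0"
  \<comment> \<open>On balls of radius \<open>r\<close> the kernel varies by at most
    \<open>d\<close>, and the total error \<open>d * A\<close> is at most \<open>e\<close>. The
    summands 1 keep the denominators positive.\<close>
  define K where "K = 4 * \<tau>\<^sup>2 * (1 + \<tau>\<^sup>2)"
  define A where "A = (\<Sum>i\<in>I. \<bar>a i\<bar>)\<^sup>2"
  define d where "d = e / (A + 1)"
  define r where "r = d / (2 * K + 1)"
  have K0: "K \<ge> 0" by (simp add: K_def)
  have A0: "A \<ge> 0" by (simp add: A_def)
  have d: "d > 0" using e A0 by (simp add: d_def add_nonneg_pos)
  have r: "r > 0" using d K0 by (simp add: r_def add_nonneg_pos)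
  have Kr: "K * (r + r) \<le> d"
  proof -
    have "(2 * K + 1) * r = d" using K0 by (simp add: r_def)
    then show ?thesis using r by (simp add: algebra_simps)
  qed
  define U where "U i = F \<inter> ball (p i) r" for i
  have Uo: "openin (top_of_set F) (U i)" for i unfolding U_def by (intro openin_open_Int) simp
  have Us: "U i \<in> sets \<rho>" for i using openin_sets[OF Uo] .
  have UF [simp]: "U i \<inter> F = U i" for i by (auto simp: U_def)
  define m where "m i = prob (U i)" for i
  have pF: "p i \<in> F" if "i \<in> I" for i using p[OF that] supp_subset by auto
  have m: "m i > 0" if "i \<in> I" for i
    unfolding m_def using p[OF that] pF[OF that] Uo r by (intro measure_pos_if_supp[of "p i"]) (auto simp: U_def)
  have iind: "integrable \<rho> (\<lambda>x. indicator (U i) x :: real)" for i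
    using Us by (intro integrable_real_indicator) (auto simp: less_top[symmetric])
  have close: "\<bar>L \<tau> x y - L \<tau> (p i) (p j)\<bar> \<le> d" if "x \<in> U i" "y \<in> U j" "i \<in> I" "j \<in> I" for x y i j
  proof -
    have "\<bar>L \<tau> x y - L \<tau> (p i) (p j)\<bar> \<le> K * (dist x (p i) + dist y (p j))"
      unfolding K_def using that pF by (intro L_Lipschitz) (auto simp: U_def)
    also have "\<dots> \<le> K * (r + r)"
      using that K0 by (intro mult_left_mono add_mono) (auto simp: U_def dist_commute)
    finally show ?thesis using Kr by linarith
  qed
  define W where "W i j = (\<integral>x. indicator (U i) x * (\<integral>y. indicator (U j) y * L \<tau> x y \<partial>\<rho>) \<partial>\<rho>)" for i j
  have indL: "integrable \<rho> (\<lambda>y. indicator (U j) y * L \<tau> x y)" for x j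
    using integrable_mult_indicator[OF Us integrable_L] by simp
  have inner_bound: "\<bar>\<integral>y. indicator (U j) y * L \<tau> x y \<partial>\<rho>\<bar> \<le> K * 2" if "x \<in> F" for x j
  proof -
    have "\<bar>\<integral>y. indicator (U j) y * L \<tau> x y \<partial>\<rho>\<bar> \<le> (\<integral>y. \<bar>indicator (U j) y * L \<tau> x y\<bar> \<partial>\<rho>)"
      by (rule integral_abs_bound)
    also have "\<dots> \<le> (\<integral>y. K * 2 \<partial>\<rho>)"
      using L_bound[OF that, of _ \<tau>] K0
      by (intro integral_mono integrable_abs indL integrable_const) (auto simp: K_def indicator_def)
    finally show ?thesis by simp
  qed
  have indW: "integrable \<rho> (\<lambda>x. indicator (U i) x * (\<integral>y. indicator (U j) y * L \<tau> x y \<partial>\<rho>))" for i j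
    using inner_bound K0 Us measurable_inner_integral[of "indicator (U j)" \<tau>]
    by (intro integrable_const_bound[of _ "K * 2"] AE_I2 borel_measurable_times borel_measurable_indicator)
      (auto simp: indicator_def)
  have W_close: "\<bar>W i j - m i * m j * L \<tau> (p i) (p j)\<bar> \<le> d * (m i * m j)" if ij: "i \<in> I" "j \<in> I" for i j
  proof -
    let ?l = "L \<tau> (p i) (p j)"
    have inner: "\<bar>(\<integral>y. indicator (U j) y * L \<tau> x y \<partial>\<rho>) - m j * ?l\<bar> \<le> d * m j" if x: "x \<in> U i" for x
    proof -
      have "(\<integral>y. indicator (U j) y * L \<tau> x y \<partial>\<rho>) - m j * ?l
          = (\<integral>y. indicator (U j) y * L \<tau> x y - indicator (U j) y * ?l \<partial>\<rho>)"
        using indL iind Us by (simp add: m_def)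
      then have "\<bar>(\<integral>y. indicator (U j) y * L \<tau> x y \<partial>\<rho>) - m j * ?l\<bar>
          \<le> (\<integral>y. \<bar>indicator (U j) y * L \<tau> x y - indicator (U j) y * ?l\<bar> \<partial>\<rho>)"
        by (simp only: integral_abs_bound)
      also have "\<dots> \<le> (\<integral>y. d * indicator (U j) y \<partial>\<rho>)"
        using close[OF x _ ij] d
        by (intro integral_mono integrable_abs Bochner_Integration.integrable_diff indL integrable_mult_right integrable_mult_left iind)
          (auto simp: indicator_def)
      finally show ?thesis using Us by (simp add: m_def)
    qed
    have "W i j - m i * m j * ?l
        = (\<integral>x. indicator (U i) x * (\<integral>y. indicator (U j) y * L \<tau> x y \<partial>\<rho>) - indicator (U i) x * (m j * ?l) \<partial>\<rho>)"
      using indW iind Us by (simp add: m_def W_def)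
    then have "\<bar>W i j - m i * m j * ?l\<bar>
        \<le> (\<integral>x. \<bar>indicator (U i) x * (\<integral>y. indicator (U j) y * L \<tau> x y \<partial>\<rho>) - indicator (U i) x * (m j * ?l)\<bar> \<partial>\<rho>)"
      by (simp only: integral_abs_bound)
    also have "\<dots> \<le> (\<integral>x. d * m j * indicator (U i) x \<partial>\<rho>)"
      using inner d m[OF ij(2)]
      by (intro integral_mono integrable_abs Bochner_Integration.integrable_diff indW integrable_mult_right integrable_mult_left iind)
        (auto simp: indicator_def)
    finally show ?thesis using Us by (simp add: m_def mult_ac)
  qed
  \<comment> \<open>This density imitates the signed measure with mass \<open>a i\<close> at
    \<open>p i\<close>.\<close>
  define g where "g x = (\<Sum>i\<in>I. a i / m i * indicator (U i) x)" for x
  have gm: "g \<in> borel_measurable \<rho>" unfolding g_def using Us by measurable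
  have gb: "\<bar>g x\<bar> \<le> (\<Sum>i\<in>I. \<bar>a i / m i\<bar>)" for x
    unfolding g_def by (intro order_trans[OF sum_abs] sum_mono) (auto simp: indicator_def)
  have "(\<integral>y. g y * L \<tau> x y \<partial>\<rho>) = (\<Sum>j\<in>I. a j / m j * (\<integral>y. indicator (U j) y * L \<tau> x y \<partial>\<rho>))" for x
    using indL by (simp add: g_def sum_distrib_right mult.assoc)
  then have "(\<integral>x. g x * (\<integral>y. g y * L \<tau> x y \<partial>\<rho>) \<partial>\<rho>)
      = (\<integral>x. (\<Sum>i\<in>I. \<Sum>j\<in>I. a i / m i * (a j / m j) * (indicator (U i) x * (\<integral>y. indicator (U j) y * L \<tau> x y \<partial>\<rho>))) \<partial>\<rho>)"
    by (simp add: g_def sum_product mult_ac)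
  also have "\<dots> = (\<Sum>i\<in>I. \<Sum>j\<in>I. a i / m i * (a j / m j) * W i j)"
    using indW by (simp add: W_def)
  finally have E: "(\<integral>x. g x * (\<integral>y. g y * L \<tau> x y \<partial>\<rho>) \<partial>\<rho>) = (\<Sum>i\<in>I. \<Sum>j\<in>I. a i / m i * (a j / m j) * W i j)" .
  \<comment> \<open>The mass term in the second variation has the nonnegative action as its
    coefficient, so the lower bound is at least 0 whatever the sum of the \<open>a i\<close>
    is.\<close>
  have "0 \<le> action \<tau> \<rho> * (\<integral>x. g x \<partial>\<rho>)\<^sup>2" using action_nonneg by simp
  also have "\<dots> \<le> (\<Sum>i\<in>I. \<Sum>j\<in>I. a i / m i * (a j / m j) * W i j)"
    using minimizer_variation(2)[OF min gm gb] by (simp only: E)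
  also have "\<dots> \<le> (\<Sum>i\<in>I. \<Sum>j\<in>I. a i * a j * L \<tau> (p i) (p j) + d * (\<bar>a i\<bar> * \<bar>a j\<bar>))"
  proof (intro sum_mono)
    fix i j assume ij: "i \<in> I" "j \<in> I"
    let ?c = "a i / m i * (a j / m j)"
    have "?c * (W i j - m i * m j * L \<tau> (p i) (p j)) \<le> \<bar>?c\<bar> * (d * (m i * m j))"
      using mult_left_mono[OF W_close[OF ij] abs_ge_zero[of ?c]] abs_ge_self[of "?c * (W i j - m i * m j * L \<tau> (p i) (p j))"]
      by (simp only: abs_mult)
    also have "\<dots> = d * (\<bar>a i\<bar> * \<bar>a j\<bar>)"
      using m[OF ij(1)] m[OF ij(2)] by (simp add: abs_mult)
    also have "?c * (W i j - m i * m j * L \<tau> (p i) (p j)) = ?c * W i j - a i * a j * L \<tau> (p i) (p j)"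
      using m[OF ij(1)] m[OF ij(2)] by (simp add: right_diff_distrib)
    finally show "?c * W i j \<le> a i * a j * L \<tau> (p i) (p j) + d * (\<bar>a i\<bar> * \<bar>a j\<bar>)" by linarith
  qed
  also have "\<dots> = (\<Sum>i\<in>I. \<Sum>j\<in>I. a i * a j * L \<tau> (p i) (p j)) + d * A"
    unfolding A_def power2_eq_square sum_product sum.distrib by (simp only: sum_distrib_left)
  also have "d * A \<le> e"
  proof -
    have "d * (A + 1) = e" using A0 by (simp add: d_def)
    then show ?thesis using d by (simp add: algebra_simps)
  qed
  finally show "0 \<le> (\<Sum>i\<in>I. \<Sum>j\<in>I. a i * a j * L \<tau> (p i) (p j)) + e" by simp
qed

end

section \<open>The light cone and great-circle arcs\<close>

text \<open>The profile vanishes at \<open>-1\<close> and at the lightlike value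
  \<open>1 - 2 / \<tau>\<^sup>2\<close>. On the sphere the first factor is nonnegative, so away from
  antipodal pairs the second factor decides the sign.\<close>

lemma D_factor:
  assumes "\<tau> \<noteq> 0"
  shows "D \<tau> x y = 2 * \<tau> ^ 4 * ((1 + x \<bullet> y) * (x \<bullet> y - (1 - 2 / \<tau>\<^sup>2)))"
  using assms by (simp add: D_def field_simps power2_eq_square power4_eq_xxxx)

lemma inner_ge_minus_one: "x \<in> F \<Longrightarrow> y \<in> F \<Longrightarrow> - 1 \<le> x \<bullet> y" for x y :: "real ^ 3"
  using Cauchy_Schwarz_ineq2[of x y] by simp

lemma L_eq_D:
  assumes "\<tau> \<noteq> 0" "x \<in> F" "y \<in> F" "1 - 2 / \<tau>\<^sup>2 \<le> x \<bullet> y"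
  shows "L \<tau> x y = D \<tau> x y"
proof -
  have "0 \<le> (1 + x \<bullet> y) * (x \<bullet> y - (1 - 2 / \<tau>\<^sup>2))"
    using inner_ge_minus_one[of x y] assms by (intro mult_nonneg_nonneg) auto
  then show ?thesis using assms by (simp add: L_def D_factor)
qed

lemma L_eq_0:
  assumes "\<tau> \<noteq> 0" "x \<in> F" "y \<in> F" "x \<bullet> y \<le> 1 - 2 / \<tau>\<^sup>2"
  shows "L \<tau> x y = 0"
proof -
  have "(1 + x \<bullet> y) * (x \<bullet> y - (1 - 2 / \<tau>\<^sup>2)) \<le> 0"
    using inner_ge_minus_one[of x y] assms by (intro mult_nonneg_nonpos) auto
  then show ?thesis using assms by (simp add: L_def D_factor mult_nonneg_nonpos)
qed

lemma lightlike_inner_pos: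
  assumes "\<tau> > sqrt 2"
  shows "0 < 1 - 2 / \<tau>\<^sup>2"
proof -
  have "(sqrt 2)\<^sup>2 < \<tau>\<^sup>2" using assms by (intro power_strict_mono) auto
  then have "2 / \<tau>\<^sup>2 < 2 / 2" by (intro divide_strict_left_mono) auto
  then show ?thesis by simp
qed

lemma orthogonal_unit_vector_exists:
  fixes x :: "real ^ 3"
  obtains v where "norm v = 1" "x \<bullet> v = 0"
proof -
  obtain w :: "real^3" where "w \<noteq> 0" "orthogonal x w"
    using orthogonal_to_vector_exists[of x] by auto
  then show thesis by (intro that[of "w /\<^sub>R norm w"]) (auto simp: orthogonal_def)
qed

lemma eq_if_inner_unit_eq_1:
  fixes x y :: "'a :: real_inner"
  assumes "norm x = 1" "norm y = 1" "x \<bullet> y = 1"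
  shows "y = x"
proof -
  have "x \<bullet> x = 1" "y \<bullet> y = 1" "y \<bullet> x = 1"
    using assms by (simp_all add: dot_square_norm inner_commute[of y x])
  then have "(x - y) \<bullet> (x - y) = 0"
    using assms(3) by (simp add: inner_diff_left inner_diff_right)
  then show ?thesis by simp
qed

text \<open>For orthonormal \<open>x\<close> and \<open>v\<close> this is a great-circle arc
  parametrized by its scalar product \<open>u\<close> with \<open>x\<close> instead of the angle. It
  reaches \<open>x\<close> at \<open>u = 1\<close>, and \<open>- v\<close> gives its mirror image;
  adding the two turns quadratic expressions into polynomials in \<open>u\<close>.\<close>

definition arc :: "real ^ 3 \<Rightarrow> real ^ 3 \<Rightarrow> real \<Rightarrow> real ^ 3" where
  "arc x v u = u *\<^sub>R x + sqrt (1 - u\<^sup>2) *\<^sub>R v"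

lemma inner_arc: "arc x v u \<bullet> y = u * (x \<bullet> y) + sqrt (1 - u\<^sup>2) * (v \<bullet> y)"
  by (simp add: arc_def inner_add_left)

lemma sqrt_one_minus_square: "0 \<le> u \<Longrightarrow> u \<le> 1 \<Longrightarrow> (sqrt (1 - u\<^sup>2))\<^sup>2 = 1 - u\<^sup>2" for u :: real
  by (simp add: power_le_one)

lemma arc_properties:
  assumes "norm x = 1" "norm v = 1" "x \<bullet> v = 0" "0 \<le> u" "u \<le> 1"
  shows arc_in_F: "arc x v u \<in> F"
    and dist_arc: "(dist x (arc x v u))\<^sup>2 = 2 - 2 * u"
    and inner_self_arc: "x \<bullet> arc x v u = u"
    and inner_arc_opposite: "arc x v u \<bullet> arc x (- v) u = 2 * u\<^sup>2 - 1"
proof -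
  note s = sqrt_one_minus_square[OF assms(4,5)]
  have xv: "x \<bullet> x = 1" "v \<bullet> v = 1" "v \<bullet> x = 0"
    using assms by (simp_all add: dot_square_norm inner_commute)
  have "arc x v u \<bullet> arc x v u = u * u + sqrt (1 - u\<^sup>2) * sqrt (1 - u\<^sup>2)"
    by (simp add: arc_def inner_add_left inner_add_right xv assms)
  also have "\<dots> = 1" using s by (simp add: power2_eq_square)
  finally have n: "arc x v u \<bullet> arc x v u = 1" .
  then show "arc x v u \<in> F" by (simp add: norm_eq_sqrt_inner)
  show i: "x \<bullet> arc x v u = u"
    by (simp add: arc_def inner_add_right xv assms)
  show "(dist x (arc x v u))\<^sup>2 = 2 - 2 * u"
    using n i xv by (simp add: dist_norm power2_norm_eq_inner inner_diff_left inner_diff_right inner_commute)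
  have "arc x v u \<bullet> arc x (- v) u = u * u - sqrt (1 - u\<^sup>2) * sqrt (1 - u\<^sup>2)"
    by (simp add: arc_def inner_add_left inner_add_right inner_diff_right xv assms)
  also have "\<dots> = 2 * u\<^sup>2 - 1" using s by (simp add: power2_eq_square)
  finally show "arc x v u \<bullet> arc x (- v) u = 2 * u\<^sup>2 - 1" .
qed

text \<open>Gram-Schmidt: \<open>v\<close> is the normalized component of \<open>y\<close>
  orthogonal to \<open>x\<close>, which is nonzero because \<open>y\<close> is neither
  \<open>x\<close> nor \<open>- x\<close>.\<close>

lemma unit_tangent_decomposition:
  fixes x y :: "real ^ 3"
  assumes x: "x \<in> F" and y: "y \<in> F" and c: "\<bar>x \<bullet> y\<bar> < 1"
  obtains v where "norm v = 1" "x \<bullet> v = 0" "v \<bullet> y = sqrt (1 - (x \<bullet> y)\<^sup>2)"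
proof -
  define c where "c = x \<bullet> y"
  define s where "s = sqrt (1 - c\<^sup>2)"
  have "c\<^sup>2 < 1" using c unfolding c_def by (simp add: abs_square_less_1)
  then have s: "s > 0" "s\<^sup>2 = 1 - c\<^sup>2" by (simp_all add: s_def)
  define v where "v = (1 / s) *\<^sub>R (y - c *\<^sub>R x)"
  have xy: "x \<bullet> x = 1" "y \<bullet> y = 1" "x \<bullet> y = c" "y \<bullet> x = c"
    using x y by (simp_all add: dot_square_norm c_def inner_commute)
  have "x \<bullet> v = 0" by (simp add: v_def inner_diff_right xy)
  moreover have vy: "v \<bullet> y = s"
  proof -
    have "v \<bullet> y = (1 / s) * (1 - c\<^sup>2)" by (simp add: v_def inner_diff_left xy power2_eq_square)
    also have "\<dots> = (1 / s) * s\<^sup>2" by (simp only: s(2))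
    finally show ?thesis using s(1) by (simp add: power2_eq_square)
  qed
  moreover have "norm v = 1"
  proof -
    have "v \<bullet> v = (1 / s) * (v \<bullet> y - c * (x \<bullet> v))"
      by (subst (2) v_def) (simp add: inner_diff_right inner_commute)
    also have "\<dots> = 1" using vy \<open>x \<bullet> v = 0\<close> s by simp
    finally show ?thesis by (simp add: norm_eq_sqrt_inner)
  qed
  ultimately show thesis using that by (simp add: s_def c_def)
qed

section \<open>Interior points of the support and the light cone\<close>

context sphere_prob
begin

text \<open>Adding the integrals for \<open>v\<close> and \<open>- v\<close> cancels the square
  roots and leaves a quadratic polynomial in \<open>u\<close>. It is constant on an interval ending
  at 1, so its linear and quadratic coefficients vanish. The weight \<open>\<kappa>\<close> allows
  for restricting the integral to a cap.\<close>

lemma moments_if_constant_on_arcs: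
  assumes \<tau>: "\<tau> \<noteq> 0" and x: "norm x = 1" and v: "norm v = 1" and xv: "x \<bullet> v = 0"
    and \<kappa>: "\<kappa> \<in> borel_measurable \<rho>" "\<And>y. \<bar>\<kappa> y\<bar> \<le> 1" and u0: "u0 < 1"
    and const: "\<And>u w. u0 \<le> u \<Longrightarrow> 0 \<le> u \<Longrightarrow> u \<le> 1 \<Longrightarrow> w \<in> {v, - v} \<Longrightarrow> (\<integral>y. \<kappa> y * D \<tau> (arc x w u) y \<partial>\<rho>) = C"
  shows "(\<integral>y. \<kappa> y * (x \<bullet> y) \<partial>\<rho>) = 0"
    and "(\<integral>y. \<kappa> y * (x \<bullet> y)\<^sup>2 \<partial>\<rho>) = (\<integral>y. \<kappa> y * (v \<bullet> y)\<^sup>2 \<partial>\<rho>)"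
proof -
  have int: "integrable \<rho> (\<lambda>y. \<kappa> y * g y)" if g: "continuous_on F g" for g :: "real^3 \<Rightarrow> real"
  proof -
    obtain B where B: "\<And>x. x \<in> F \<Longrightarrow> \<bar>g x\<bar> \<le> B" using bounded_continuous_on_F[OF g] by blast
    have "\<bar>\<kappa> y * g y\<bar> \<le> B" if "y \<in> F" for y
      using mult_mono[OF \<kappa>(2)[of y] B[OF that]] by (simp add: abs_mult)
    then show ?thesis
      using \<kappa>(1) measurable_continuous_on_F[OF g] by (intro integrable_const_bound[of _ B] AE_I2) auto
  qed
  define k where "k = (\<integral>y. \<kappa> y \<partial>\<rho>)"
  define A where "A = (\<integral>y. \<kappa> y * (x \<bullet> y) \<partial>\<rho>)"
  define Q where "Q = (\<integral>y. \<kappa> y * (x \<bullet> y)\<^sup>2 \<partial>\<rho>)"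
  define R where "R = (\<integral>y. \<kappa> y * (v \<bullet> y)\<^sup>2 \<partial>\<rho>)"
  have i: "integrable \<rho> \<kappa>" "integrable \<rho> (\<lambda>y. \<kappa> y * (x \<bullet> y))"
    "integrable \<rho> (\<lambda>y. \<kappa> y * (x \<bullet> y)\<^sup>2)" "integrable \<rho> (\<lambda>y. \<kappa> y * (v \<bullet> y)\<^sup>2)"
    using int[of "\<lambda>_. 1"] by (auto intro!: int continuous_intros)
  have J: "2 * C = 4 * \<tau>\<^sup>2 * (2 - \<tau>\<^sup>2) * k + 8 * \<tau>\<^sup>2 * u * A + 4 * \<tau> ^ 4 * (u\<^sup>2 * Q + (1 - u\<^sup>2) * R)"
    if u: "u0 \<le> u" "0 \<le> u" "u \<le> 1" for u
  proof -
    have "2 * C = (\<integral>y. \<kappa> y * D \<tau> (arc x v u) y \<partial>\<rho>) + (\<integral>y. \<kappa> y * D \<tau> (arc x (- v) u) y \<partial>\<rho>)"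
      using const[OF u] by simp
    also have "\<dots> = (\<integral>y. \<kappa> y * D \<tau> (arc x v u) y + \<kappa> y * D \<tau> (arc x (- v) u) y \<partial>\<rho>)"
      by (intro Bochner_Integration.integral_add[symmetric] int continuous_intros)
    also have "\<dots> = (\<integral>y. (4 * \<tau>\<^sup>2 * (2 - \<tau>\<^sup>2)) * \<kappa> y + (8 * \<tau>\<^sup>2 * u) * (\<kappa> y * (x \<bullet> y))
        + ((4 * \<tau> ^ 4 * u\<^sup>2) * (\<kappa> y * (x \<bullet> y)\<^sup>2) + (4 * \<tau> ^ 4 * (1 - u\<^sup>2)) * (\<kappa> y * (v \<bullet> y)\<^sup>2)) \<partial>\<rho>)"
    proof (intro Bochner_Integration.integral_cong refl)
      fix y
      let ?s = "sqrt (1 - u\<^sup>2)"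
      have "(u * (x \<bullet> y) + ?s * (v \<bullet> y))\<^sup>2 + (u * (x \<bullet> y) - ?s * (v \<bullet> y))\<^sup>2
          = 2 * (u\<^sup>2 * (x \<bullet> y)\<^sup>2 + ?s\<^sup>2 * (v \<bullet> y)\<^sup>2)"
        by (simp add: power2_eq_square algebra_simps)
      also have "?s\<^sup>2 = 1 - u\<^sup>2" using sqrt_one_minus_square u by blast
      finally have sq: "(arc x v u \<bullet> y)\<^sup>2 + (arc x (- v) u \<bullet> y)\<^sup>2 = 2 * (u\<^sup>2 * (x \<bullet> y)\<^sup>2 + (1 - u\<^sup>2) * (v \<bullet> y)\<^sup>2)"
        by (simp add: inner_arc)
      have lin: "arc x v u \<bullet> y + arc x (- v) u \<bullet> y = 2 * u * (x \<bullet> y)"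
        by (simp add: inner_arc)
      have "\<kappa> y * D \<tau> (arc x v u) y + \<kappa> y * D \<tau> (arc x (- v) u) y
          = \<kappa> y * (4 * \<tau>\<^sup>2 * (2 - \<tau>\<^sup>2) + 4 * \<tau>\<^sup>2 * (arc x v u \<bullet> y + arc x (- v) u \<bullet> y)
             + 2 * \<tau> ^ 4 * ((arc x v u \<bullet> y)\<^sup>2 + (arc x (- v) u \<bullet> y)\<^sup>2))"
        unfolding D_expand by (simp add: algebra_simps)
      also have "\<dots> = (4 * \<tau>\<^sup>2 * (2 - \<tau>\<^sup>2)) * \<kappa> y + (8 * \<tau>\<^sup>2 * u) * (\<kappa> y * (x \<bullet> y))
        + ((4 * \<tau> ^ 4 * u\<^sup>2) * (\<kappa> y * (x \<bullet> y)\<^sup>2) + (4 * \<tau> ^ 4 * (1 - u\<^sup>2)) * (\<kappa> y * (v \<bullet> y)\<^sup>2))"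
        unfolding sq lin by (simp add: algebra_simps)
      finally show "\<kappa> y * D \<tau> (arc x v u) y + \<kappa> y * D \<tau> (arc x (- v) u) y = \<dots>" .
    qed
    also have "\<dots> = (4 * \<tau>\<^sup>2 * (2 - \<tau>\<^sup>2)) * k + (8 * \<tau>\<^sup>2 * u) * A + ((4 * \<tau> ^ 4 * u\<^sup>2) * Q + (4 * \<tau> ^ 4 * (1 - u\<^sup>2)) * R)"
      using i by (simp add: k_def A_def Q_def R_def)
    finally show ?thesis by (simp add: algebra_simps)
  qed
  \<comment> \<open>Subtracting \<open>J\<close> at 1 from \<open>J\<close> at \<open>u\<close>
    leaves the factor \<open>u - 1\<close>. The remaining factor is affine in \<open>u\<close>; its
    values at \<open>u1\<close> and \<open>u2\<close> below force \<open>Q = R\<close> and then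
    \<open>A = 0\<close>.\<close>
  have lin: "2 * A + \<tau>\<^sup>2 * (u + 1) * (Q - R) = 0" if u: "u0 \<le> u" "0 \<le> u" "u < 1" for u
  proof -
    have "4 * \<tau>\<^sup>2 * (u - 1) * (2 * A + \<tau>\<^sup>2 * (u + 1) * (Q - R)) = 0"
      using J[of u] J[of 1] u u0 by (simp add: algebra_simps power2_eq_square power4_eq_xxxx)
    then show ?thesis using u \<tau> by simp
  qed
  define u1 where "u1 = max u0 0"
  define u2 where "u2 = (u1 + 1) / 2"
  have u1: "u0 \<le> u1" "0 \<le> u1" "u1 < 1" using u0 by (auto simp: u1_def)
  then have u2: "u0 \<le> u2" "0 \<le> u2" "u2 < 1" "u1 < u2" by (auto simp: u2_def)
  have "\<tau>\<^sup>2 * (u2 - u1) * (Q - R) = 0"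
    using lin[OF u1] lin[OF u2(1-3)] by (simp add: algebra_simps)
  then have "Q = R" using u2 \<tau> by simp
  then show "(\<integral>y. \<kappa> y * (x \<bullet> y)\<^sup>2 \<partial>\<rho>) = (\<integral>y. \<kappa> y * (v \<bullet> y)\<^sup>2 \<partial>\<rho>)" by (simp add: Q_def R_def)
  show "(\<integral>y. \<kappa> y * (x \<bullet> y) \<partial>\<rho>) = 0" using lin[OF u1] \<open>Q = R\<close> by (simp add: A_def)
qed

text \<open>If \<open>x \<bullet> y\<close> were the lightlike value, then
  \<open>L \<tau> y x = 0\<close>, so \<open>k\<close> below is the second difference of
  \<open>L \<tau> y\<close> at \<open>x\<close>. The Gram inequality gives
  \<open>k\<^sup>2 \<le> q1 * B\<close> with \<open>B\<close> of order \<open>h ^ 4\<close>, hence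
  \<open>k\<close> is of order at most \<open>h\<^sup>2\<close>. The kink makes \<open>k\<close> at
  least a positive multiple of \<open>h\<close> minus a term of order
  \<open>h\<^sup>2\<close>.\<close>

lemma light_cone_avoids_interior:
  assumes min: "minimizer \<tau> \<rho>" and \<tau>: "\<tau> > 1"
    and U: "openin (top_of_set F) U" "U \<subseteq> supp \<rho>" "x \<in> U" and y: "y \<in> supp \<rho>"
  shows "x \<bullet> y \<noteq> 1 - 2 / \<tau>\<^sup>2"
proof
  define c where "c = 1 - 2 / \<tau>\<^sup>2"
  assume "x \<bullet> y = 1 - 2 / \<tau>\<^sup>2"
  then have xy: "x \<bullet> y = c" by (simp add: c_def)
  have xs: "x \<in> supp \<rho>" using U by auto
  have xF: "x \<in> F" and yF: "y \<in> F" using xs y supp_subset by auto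
  have \<tau>0: "\<tau> \<noteq> 0" using \<tau> by simp
  have "2 / \<tau>\<^sup>2 < 2 / 1" using \<tau> by (intro divide_strict_left_mono) auto
  then have c: "- 1 < c" "c < 1" using \<tau>0 by (simp_all add: c_def)
  define s where "s = sqrt (1 - c\<^sup>2)"
  have "\<bar>c\<bar> < 1" using c by auto
  then have s: "s > 0" by (simp add: s_def abs_square_less_1)
  obtain v where v: "norm v = 1" "x \<bullet> v = 0" "v \<bullet> y = s"
    using unit_tangent_decomposition[OF xF yF] \<open>\<bar>c\<bar> < 1\<close> xy by (auto simp: s_def)
  obtain e where e: "e > 0" "\<And>z. z \<in> F \<Longrightarrow> dist z x < e \<Longrightarrow> z \<in> supp \<rho>"
    using U unfolding openin_euclidean_subtopology_iff by blast
  \<comment> \<open>\<open>a\<close> is the slope of the profile at the lightlike value, that is,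
    the size of the kink. \<open>G\<close> collects the coefficients of \<open>h\<^sup>2\<close> in
    the upper and lower bounds for \<open>k\<close>.\<close>
  define a where "a = 2 * \<tau> ^ 4 * (1 + c)"
  define G where "G = 32 * \<tau>\<^sup>2 * (1 + \<tau>\<^sup>2) + a * \<bar>c\<bar>"
  have a: "a > 0" using \<tau>0 c by (simp add: a_def)
  have G: "G > 0" using a by (simp add: G_def add_pos_nonneg \<tau>0)
  \<comment> \<open>In turn the upper bounds keep \<open>u = 1 - h\<^sup>2\<close> in the unit
    interval, keep the three points near \<open>x\<close> inside each other's light cones, keep the
    arc points in the support, and contradict the final estimate
    \<open>a * s \<le> G * h\<close>.\<close>
  obtain h where h: "h > 0" "h < 1 / 2" "h < (1 - c) / 4" "h < e / 2" "h < a * s / G"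
  proof -
    define m where "m = Min {1 / 2, (1 - c) / 4, e / 2, a * s / G}"
    have "m > 0" using c e a s G by (simp add: m_def)
    moreover have "m \<le> 1 / 2" "m \<le> (1 - c) / 4" "m \<le> e / 2" "m \<le> a * s / G"
      unfolding m_def by (rule Min_le; simp)+
    ultimately show thesis by (intro that[of "m / 2"]; linarith)
  qed
  have hh: "h\<^sup>2 \<le> h" "h\<^sup>2 \<le> 1 / 4"
  proof -
    show "h\<^sup>2 \<le> h" using h by (simp add: power2_eq_square mult_left_le)
    then have "h\<^sup>2 \<le> h * (1/2)" using h unfolding power2_eq_square by (intro mult_left_mono) auto
    then show "h\<^sup>2 \<le> 1 / 4" using h by linarith
  qed
  define u where "u = 1 - h\<^sup>2"
  have u: "0 \<le> u" "u \<le> 1" using hh by (auto simp: u_def)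
  define xp xm where "xp = arc x v u" and "xm = arc x (- v) u"
  have nx: "norm x = 1" and v': "norm (- v) = 1" "x \<bullet> (- v) = 0" using xF v by auto
  note p = arc_properties[OF nx v(1,2) u, folded xp_def xm_def]
  note q = arc_properties[OF nx v' u, folded xm_def]
  have small: "2 - 2 * u < e\<^sup>2"
  proof -
    have "2 - 2 * u = 2 * h\<^sup>2" by (simp add: u_def)
    also have "\<dots> < 4 * h\<^sup>2" using h by simp
    also have "\<dots> = (2 * h)\<^sup>2" by simp
    also have "\<dots> \<le> e\<^sup>2" using h by (intro power_mono) auto
    finally show ?thesis .
  qed
  have ps: "xp \<in> supp \<rho>"
    using p small e by (intro e(2)) (auto simp: dist_commute intro: power2_less_imp_less)
  have ms: "xm \<in> supp \<rho>"
    using q small e by (intro e(2)) (auto simp: dist_commute intro: power2_less_imp_less)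
  \<comment> \<open>\<open>2 * u\<^sup>2 - 1\<close> is the scalar product of \<open>xp\<close> and
    \<open>xm\<close>. Hence \<open>L\<close> equals the polynomial \<open>D\<close> on all pairs
    from \<open>x\<close>, \<open>xp\<close>, \<open>xm\<close>, and the self-energy can be computed
    exactly.\<close>
  have uc: "c \<le> 2 * u\<^sup>2 - 1"
  proof -
    have "1 - 2 * w \<le> (1 - w)\<^sup>2" for w :: real by (simp add: power2_eq_square algebra_simps)
    then have "1 - 2 * h\<^sup>2 \<le> u\<^sup>2" by (simp only: u_def)
    moreover have "h * 4 < 1 - c" using h(3) by simp
    ultimately have "c + 1 \<le> u\<^sup>2 * 2" using hh(1) by linarith
    then show ?thesis by simp
  qed
  moreover have "u\<^sup>2 \<le> u" using u by (simp add: power2_eq_square mult_left_le)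
  ultimately have uc': "c \<le> u" using u by linarith
  define k where "k = L \<tau> y xp + L \<tau> y xm"
  define q1 where "q1 = 8 * \<tau>\<^sup>2"
  have LF: "L \<tau> z z = q1" if "z \<in> F" for z
    using that by (simp add: L_def D_def dot_square_norm q1_def)
  have Lxy: "L \<tau> y x = 0" using \<tau>0 xF yF xy by (intro L_eq_0) (auto simp: c_def inner_commute)
  have Lx: "L \<tau> x xp = prof \<tau> u" "L \<tau> x xm = prof \<tau> u"
    using \<tau>0 xF p q uc' by (auto simp: c_def L_eq_D D_eq_prof)
  have Lpm: "L \<tau> xp xm = prof \<tau> (2 * u\<^sup>2 - 1)"
    using \<tau>0 p q uc by (auto simp: c_def L_eq_D D_eq_prof)
  \<comment> \<open>\<open>B\<close> is the self-energy of the second difference with coefficients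
    1, -2, 1 at \<open>xp\<close>, \<open>x\<close>, \<open>xm\<close>; \<open>q1\<close> is the
    value of \<open>L\<close> on the diagonal.\<close>
  define B where "B = 6 * q1 + 2 * prof \<tau> (2 * u\<^sup>2 - 1) - 8 * prof \<tau> u"
  txt \<open>The test measure is \<open>- k \<delta>(y) + q1 (\<delta>(xp) - 2 \<delta>(x) + \<delta>(xm))\<close>; its first coefficient minimizes the
    energy for the given second one.\<close>
  let ?p = "\<lambda>i::nat. if i = 0 then y else if i = 1 then xp else if i = 2 then x else xm"
  let ?a = "\<lambda>i::nat. if i = 0 then - k else if i = 1 then q1 else if i = 2 then - 2 * q1 else q1"
  have "0 \<le> (\<Sum>i\<in>{0,1,2,3}. \<Sum>j\<in>{0,1,2,3}. ?a i * ?a j * L \<tau> (?p i) (?p j))"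
    by (rule minimizer_Gram_nonneg[OF min]) (use y ps xs ms in auto)
  also have "\<dots> = q1 * (q1 * B - k\<^sup>2)"
  proof -
    have "L \<tau> xm xp = prof \<tau> (2 * u\<^sup>2 - 1)" "L \<tau> xp x = prof \<tau> u" "L \<tau> xm x = prof \<tau> u" "L \<tau> x y = 0"
      "L \<tau> xm y = L \<tau> y xm" "L \<tau> xp y = L \<tau> y xp"
      using Lpm Lx Lxy by (simp_all add: L_commute[of \<tau> xm xp] L_commute[of \<tau> xp x] L_commute[of \<tau> xm x]
          L_commute[of \<tau> x y] L_commute[of \<tau> xm y] L_commute[of \<tau> xp y])
    then show ?thesis
      using LF[OF xF] LF[OF yF] LF[OF p(1)] LF[OF q(1)] Lpm Lx Lxy
      by (simp add: B_def k_def algebra_simps power2_eq_square)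
  qed
  finally have "k\<^sup>2 \<le> q1 * B" using \<tau>0 by (simp add: q1_def zero_le_mult_iff)
  also have "q1 * B \<le> (32 * \<tau>\<^sup>2 * (1 + \<tau>\<^sup>2) * h\<^sup>2)\<^sup>2"
  proof -
    have "B = 16 * \<tau>\<^sup>2 * (h\<^sup>2)\<^sup>2 * (1 + \<tau>\<^sup>2 * (1 + u)\<^sup>2)"
      by (simp add: B_def q1_def u_def prof_def power2_eq_square algebra_simps)
    also have "\<dots> \<le> 16 * \<tau>\<^sup>2 * (h\<^sup>2)\<^sup>2 * (1 + \<tau>\<^sup>2 * 2\<^sup>2)"
      using u by (intro mult_left_mono add_left_mono power_mono) auto
    finally have "q1 * B \<le> q1 * (16 * \<tau>\<^sup>2 * (h\<^sup>2)\<^sup>2 * (1 + \<tau>\<^sup>2 * 2\<^sup>2))"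
      by (intro mult_left_mono) (auto simp: q1_def)
    also have "\<dots> = 128 * (\<tau>\<^sup>2 * h\<^sup>2)\<^sup>2 * (1 + 4 * \<tau>\<^sup>2)"
      by (simp add: q1_def power2_eq_square algebra_simps)
    \<comment> \<open>The factor 8 is chosen because \<open>128 * 8 = 32\<^sup>2\<close> makes the
      bound a perfect square, so that a root can be taken.\<close>
    also have "\<dots> \<le> 128 * (\<tau>\<^sup>2 * h\<^sup>2)\<^sup>2 * (8 * (1 + \<tau>\<^sup>2)\<^sup>2)"
    proof (intro mult_left_mono)
      have "1 + 4 * w \<le> 8 * (1 + w)\<^sup>2" if "0 \<le> w" for w :: real
      proof -
        have "0 \<le> w * w" by simp
        with that have "0 \<le> 7 + 12 * w + 8 * (w * w)" by linarith
        then show ?thesis by (simp add: power2_eq_square algebra_simps)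
      qed
      then show "1 + 4 * \<tau>\<^sup>2 \<le> 8 * (1 + \<tau>\<^sup>2)\<^sup>2" by simp
    qed simp
    also have "\<dots> = (32 * \<tau>\<^sup>2 * (1 + \<tau>\<^sup>2) * h\<^sup>2)\<^sup>2"
      by (simp add: power_mult_distrib)
    finally show ?thesis .
  qed
  finally have k_le: "k \<le> 32 * \<tau>\<^sup>2 * (1 + \<tau>\<^sup>2) * h\<^sup>2"
    by (rule power2_le_imp_le) simp
  define t where "t = xp \<bullet> y"
  have t: "t = c * u + s * sqrt (1 - u\<^sup>2)"
    by (simp add: t_def xp_def inner_arc xy v mult_ac)
  \<comment> \<open>The tangential component of the arc point is of first order in \<open>h\<close>,
    so moving towards \<open>y\<close> raises the scalar product with \<open>y\<close> by at least
    \<open>s * h\<close> up to order \<open>h\<^sup>2\<close>.\<close>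
  have "h \<le> sqrt (1 - u\<^sup>2)"
  proof (rule real_le_rsqrt)
    have "1 - u\<^sup>2 = h\<^sup>2 * (1 + u)" by (simp add: u_def power2_eq_square algebra_simps)
    then show "h\<^sup>2 \<le> 1 - u\<^sup>2" using u by (simp add: mult_le_cancel_left1)
  qed
  then have "s * h \<le> s * sqrt (1 - u\<^sup>2)" using s by simp
  moreover have "c * h\<^sup>2 \<le> \<bar>c\<bar> * h\<^sup>2" by (intro mult_right_mono) auto
  ultimately have tc: "s * h - \<bar>c\<bar> * h\<^sup>2 \<le> t - c"
    by (simp add: t u_def algebra_simps)
  \<comment> \<open>Inside the light cone \<open>D\<close> lies above its tangent line of slope
    \<open>a\<close>; outside it the left-hand side is nonpositive anyway.\<close>
  have "a * (s * h - \<bar>c\<bar> * h\<^sup>2) \<le> k"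
  proof (cases "c \<le> t")
    case True
    have "a * (s * h - \<bar>c\<bar> * h\<^sup>2) \<le> a * (t - c)" using tc a by simp
    also have "\<dots> \<le> 2 * \<tau> ^ 4 * ((1 + t) * (t - c))"
    proof -
      have "(1 + c) * (t - c) \<le> (1 + t) * (t - c)" using True by (intro mult_right_mono) auto
      then have "2 * \<tau> ^ 4 * ((1 + c) * (t - c)) \<le> 2 * \<tau> ^ 4 * ((1 + t) * (t - c))"
        by (intro mult_left_mono) auto
      then show ?thesis by (simp add: a_def mult.assoc)
    qed
    also have "\<dots> = D \<tau> y xp" using \<tau>0 by (simp add: D_factor t_def c_def inner_commute)
    also have "\<dots> \<le> k" by (simp add: k_def L_def)
    finally show ?thesis .
  next
    case False
    then have "a * (s * h - \<bar>c\<bar> * h\<^sup>2) \<le> 0" using tc a by (intro mult_nonneg_nonpos) auto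
    also have "0 \<le> k" by (simp add: k_def L_def)
    finally show ?thesis .
  qed
  with k_le have "a * s * h \<le> G * h\<^sup>2" by (simp add: G_def algebra_simps)
  then have "a * s \<le> G * h" using h by (simp add: power2_eq_square)
  then show False using h(5) G by (simp add: pos_less_divide_eq mult.commute)
qed

text \<open>Along short arcs from an interior point \<open>x\<close> the potential equals the
  integral of \<open>D\<close> over one fixed cap. As it is constant there,
  \<open>moments_if_constant_on_arcs\<close> makes the integral of \<open>x \<bullet> y\<close> over
  the cap 0, but the integrand exceeds \<open>c > 0\<close> on the cap and the cap has positive
  mass.\<close>

lemma interior_supp_empty:
  assumes min: "minimizer \<tau> \<rho>" and \<tau>: "\<tau> > sqrt 2"
  shows "(top_of_set F) interior_of (supp \<rho>) = {}"
proof (rule ccontr)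
  define c where "c = 1 - 2 / \<tau>\<^sup>2"
  define U where "U = (top_of_set F) interior_of (supp \<rho>)"
  assume "(top_of_set F) interior_of (supp \<rho>) \<noteq> {}"
  then obtain x where xU: "x \<in> U" unfolding U_def by blast
  have U: "openin (top_of_set F) U" "U \<subseteq> supp \<rho>"
    by (auto simp: U_def openin_interior_of interior_of_subset)
  have \<tau>1: "\<tau> > 1" using \<tau> real_sqrt_gt_1_iff[of 2] by linarith
  have \<tau>0: "\<tau> \<noteq> 0" using \<tau>1 by simp
  have c: "c > 0" unfolding c_def by (rule lightlike_inner_pos[OF \<tau>])
  have xs: "x \<in> supp \<rho>" and xF: "x \<in> F" using xU U supp_subset by auto
  then have nx: "norm x = 1" by simp
  obtain v where v: "norm v = 1" "x \<bullet> v = 0" by (rule orthogonal_unit_vector_exists)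
  obtain e where e: "e > 0" "\<And>z. z \<in> F \<Longrightarrow> dist z x < e \<Longrightarrow> z \<in> U"
    using U xU unfolding openin_euclidean_subtopology_iff by blast
  \<comment> \<open>For \<open>u \<ge> u0\<close> the squared distance \<open>2 - 2 * u\<close> from
    the arc point to \<open>x\<close> is at most half of \<open>e\<^sup>2\<close>.\<close>
  define u0 where "u0 = 1 - e\<^sup>2 / 4"
  have u0: "u0 < 1" using e by (simp add: u0_def)
  \<comment> \<open>The cap belongs to \<open>x\<close>, not to the moving arc point: no point of
    the support crosses the light cone along the arc, so one cap serves for all arc points.\<close>
  define \<kappa> :: "real^3 \<Rightarrow> real" where "\<kappa> y = indicator {y \<in> F. c < x \<bullet> y} y" for y
  have op: "openin (top_of_set F) {y \<in> F. c < x \<bullet> y}"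
  proof -
    have "open {y. c < x \<bullet> y}" by (intro open_Collect_less continuous_intros)
    then have "openin (top_of_set F) (F \<inter> {y. c < x \<bullet> y})" by (rule openin_open_Int)
    then show ?thesis by (simp add: Int_def)
  qed
  have \<kappa>m: "\<kappa> \<in> borel_measurable \<rho>"
    unfolding \<kappa>_def using openin_sets[OF op] by simp
  have arcU: "arc x w u \<in> U" if "u0 \<le> u" "0 \<le> u" "u \<le> 1" "w \<in> {v, - v}" for u w
  proof -
    have w: "norm w = 1" "x \<bullet> w = 0" using that v by auto
    have "e\<^sup>2 > 0" using e by simp
    then have "2 - 2 * u < e\<^sup>2" using that(1) unfolding u0_def by linarith
    then show ?thesis
      using arc_properties[OF nx w that(2,3)] e
      by (intro e(2)) (auto simp: dist_commute intro: power2_less_imp_less)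
  qed
  have const: "(\<integral>y. \<kappa> y * D \<tau> (arc x w u) y \<partial>\<rho>) = action \<tau> \<rho>"
    if u: "u0 \<le> u" "0 \<le> u" "u \<le> 1" and w: "w \<in> {v, - v}" for u w
  proof -
    have zU: "arc x w u \<in> U" by (rule arcU[OF u w])
    have zF: "arc x w u \<in> F" using zU U supp_subset by auto
    have eq: "\<kappa> y * D \<tau> (arc x w u) y = L \<tau> (arc x w u) y" if y: "y \<in> supp \<rho>" for y
    proof -
      have yF: "y \<in> F" using y supp_subset by auto
      define f where "f r = arc x w r \<bullet> y" for r
      txt \<open>By the intermediate value theorem, the arc cannot cross the light cone of \<open>y\<close>.\<close>
      have f_cont: "continuous_on {u..1} f"
        unfolding f_def arc_def by (intro continuous_intros)
      have f_ne: "f r \<noteq> c" if "r \<in> {u..1}" for r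
        unfolding f_def c_def
        using that u w y by (intro light_cone_avoids_interior[OF min \<tau>1 U arcU]) auto
      have f1: "f 1 = x \<bullet> y" by (simp add: f_def arc_def)
      have gt: "f u > c" if "x \<bullet> y > c"
      proof (rule ccontr)
        assume "\<not> f u > c"
        then have "\<exists>r\<ge>u. r \<le> 1 \<and> f r = c"
          using that u f1 f_cont by (intro IVT') auto
        then show False using f_ne by auto
      qed
      have lt: "f u < c" if "x \<bullet> y < c"
      proof (rule ccontr)
        assume "\<not> f u < c"
        then have "\<exists>r\<ge>u. r \<le> 1 \<and> f r = c"
          using that u f1 f_cont by (intro IVT2') auto
        then show False using f_ne by auto
      qed
      have "x \<bullet> y \<noteq> c" using f_ne[of 1] u f1 by auto
      then consider "x \<bullet> y > c" | "x \<bullet> y < c" by linarith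
      then show ?thesis
      proof cases
        case 1
        then show ?thesis using gt[OF 1] \<tau>0 zF yF
          by (simp add: \<kappa>_def f_def L_eq_D c_def)
      next
        case 2
        then show ?thesis using lt[OF 2] \<tau>0 zF yF
          by (simp add: \<kappa>_def f_def L_eq_0 c_def)
      qed
    qed
    have "(\<integral>y. \<kappa> y * D \<tau> (arc x w u) y \<partial>\<rho>) = potential \<tau> (arc x w u)"
      unfolding potential_def
    proof (rule integral_cong_AE)
      show "AE y in \<rho>. \<kappa> y * D \<tau> (arc x w u) y = L \<tau> (arc x w u) y"
        using AE_supp eq by auto
      show "(\<lambda>y. \<kappa> y * D \<tau> (arc x w u) y) \<in> borel_measurable \<rho>"
        by (intro borel_measurable_times \<kappa>m measurable_continuous_on_F continuous_intros)
      show "L \<tau> (arc x w u) \<in> borel_measurable \<rho>"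
        by (rule borel_measurable_integrable[OF integrable_L])
    qed
    also have "\<dots> = action \<tau> \<rho>" using potential_on_supp[OF min] zU U by blast
    finally show ?thesis .
  qed
  have "(\<integral>y. \<kappa> y * (x \<bullet> y) \<partial>\<rho>) = 0"
    using moments_if_constant_on_arcs(1)[OF \<tau>0 nx v \<kappa>m _ u0 const] by (auto simp: \<kappa>_def indicator_def)
  moreover have "(\<integral>y. c * \<kappa> y \<partial>\<rho>) \<le> (\<integral>y. \<kappa> y * (x \<bullet> y) \<partial>\<rho>)"
  proof (rule integral_mono)
    show "integrable \<rho> (\<lambda>y. c * \<kappa> y)"
      by (intro integrable_mult_right integrable_const_bound[OF _ \<kappa>m, of 1]) (simp add: \<kappa>_def indicator_def)
    show "integrable \<rho> (\<lambda>y. \<kappa> y * (x \<bullet> y))"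
    proof -
      have "integrable \<rho> (\<lambda>y. x \<bullet> y)" by (intro integrable_continuous_on_F continuous_intros)
      from integrable_mult_indicator[OF openin_sets[OF op] this] show ?thesis
        by (simp add: \<kappa>_def indicator_def)
    qed
  qed (auto simp: \<kappa>_def indicator_def)
  moreover have "(\<integral>y. c * \<kappa> y \<partial>\<rho>) > 0"
  proof -
    have "c < 1" using \<tau>0 by (simp add: c_def)
    then have "x \<in> {y \<in> F. c < x \<bullet> y}" using nx by (simp add: dot_square_norm)
    from measure_pos_if_supp[OF xs op this] have "prob {y \<in> F. c < x \<bullet> y} > 0" .
    moreover have "(\<integral>y. \<kappa> y \<partial>\<rho>) = prob {y \<in> F. c < x \<bullet> y}"
    proof -
      have "{y \<in> F. c < x \<bullet> y} \<inter> F = {y \<in> F. c < x \<bullet> y}" by auto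
      then show ?thesis unfolding \<kappa>_def using openin_sets[OF op] by simp
    qed
    ultimately show ?thesis using c by simp
  qed
  ultimately show False by linarith
qed


section \<open>Failure of generic timelikeness above the critical parameter\<close>

text \<open>Constancy of the integral of \<open>D\<close> makes the first moment along a support
  point \<open>x\<close> vanish and the second moments along \<open>x\<close> and an orthogonal
  \<open>v\<close> agree. If \<open>- x\<close> is not in the support, then
  \<open>x \<bullet> y \<ge> c > 0\<close> on the support contradicts the former; otherwise the
  support lies in \<open>{x, - x}\<close>, which contradicts the latter.\<close>

lemma not_generically_timelike:
  assumes \<tau>: "\<tau> > sqrt 2"
  shows "\<not> generically_timelike \<tau> \<rho>"
proof
  define c where "c = 1 - 2 / \<tau>\<^sup>2"
  assume g: "generically_timelike \<tau> \<rho>"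
  have \<tau>0: "\<tau> \<noteq> 0" using \<tau> real_sqrt_ge_0_iff[of 2] by linarith
  have c: "c > 0" unfolding c_def by (rule lightlike_inner_pos[OF \<tau>])
  \<comment> \<open>\<open>D\<close> also vanishes at antipodal pairs, so these remain admissible
    beside the cap.\<close>
  have timelike: "x \<bullet> y = - 1 \<or> c \<le> x \<bullet> y" if "x \<in> supp \<rho>" "y \<in> supp \<rho>" for x y
  proof (rule ccontr)
    assume n: "\<not> (x \<bullet> y = - 1 \<or> c \<le> x \<bullet> y)"
    have "- 1 \<le> x \<bullet> y" using inner_ge_minus_one that supp_subset by blast
    then have "(1 + x \<bullet> y) * (x \<bullet> y - c) < 0" using n by (intro mult_pos_neg) auto
    then have "D \<tau> x y < 0"
      using \<tau>0 unfolding D_factor[OF \<tau>0] c_def[symmetric] by (simp add: mult_pos_neg)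
    then show False using g that by (force simp: generically_timelike_def)
  qed
  obtain C where C: "\<And>x. x \<in> F \<Longrightarrow> (\<integral>y. D \<tau> x y \<partial>\<rho>) = C"
    using g by (auto simp: generically_timelike_def constant_on_def)
  obtain x where xs: "x \<in> supp \<rho>" using supp_nonempty by auto
  then have xF: "x \<in> F" and nx: "norm x = 1" using supp_subset by auto
  obtain v where v: "norm v = 1" "x \<bullet> v = 0" by (rule orthogonal_unit_vector_exists)
  have const: "(\<integral>y. 1 * D \<tau> (arc x w u) y \<partial>\<rho>) = C" if "0 \<le> u" "0 \<le> u" "u \<le> 1" "w \<in> {v, - v}" for u w
    using that v nx by (auto intro!: C arc_in_F)
  have one: "(\<lambda>_. 1 :: real) \<in> borel_measurable \<rho>" by simp
  note moments = moments_if_constant_on_arcs[OF \<tau>0 nx v one _ zero_less_one const, simplified]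
  have int: "integrable \<rho> (\<lambda>y. x \<bullet> y)" by (intro integrable_continuous_on_F continuous_intros)
  show False
  proof (cases "- x \<in> supp \<rho>")
    case False
    have ge: "c \<le> x \<bullet> y" if y: "y \<in> supp \<rho>" for y
    proof (rule ccontr)
      assume "\<not> c \<le> x \<bullet> y"
      then have "x \<bullet> y = - 1" using timelike[OF xs y] by auto
      then have "y = - x" using eq_if_inner_unit_eq_1[of "- x" y] nx y supp_subset by auto
      then show False using False y by simp
    qed
    have "(\<integral>y. c \<partial>\<rho>) \<le> (\<integral>y. x \<bullet> y \<partial>\<rho>)"
      using AE_supp ge int by (intro integral_mono_AE) auto
    then show False using moments(1) c by simp
  next
    case True
    have pm: "y = x \<or> y = - x" if y: "y \<in> supp \<rho>" for y
    proof -
      have yF: "norm y = 1" using y supp_subset by auto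
      \<comment> \<open>Comparing \<open>y\<close> with both \<open>x\<close> and \<open>- x\<close>
        rules out the caps at once, since \<open>x \<bullet> y\<close> and its negative cannot both
        be at least \<open>c > 0\<close>.\<close>
      consider "x \<bullet> y = - 1" | "x \<bullet> y = 1"
        using timelike[OF xs y] timelike[OF True y] c by auto
      then show ?thesis
        using eq_if_inner_unit_eq_1[of x y] eq_if_inner_unit_eq_1[of "- x" y] nx yF by cases auto
    qed
    have "(\<integral>y. (x \<bullet> y)\<^sup>2 \<partial>\<rho>) = (\<integral>y. 1 \<partial>\<rho>)"
    proof (rule integral_cong_AE)
      show "AE y in \<rho>. (x \<bullet> y)\<^sup>2 = 1"
        using AE_supp
      proof eventually_elim
        case (elim y)
        then show ?case using pm[OF elim] nx by (auto simp: dot_square_norm)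
      qed
    qed (auto intro!: measurable_continuous_on_F continuous_intros)
    moreover have "(\<integral>y. (v \<bullet> y)\<^sup>2 \<partial>\<rho>) = (\<integral>y. 0 \<partial>\<rho>)"
    proof (rule integral_cong_AE)
      show "AE y in \<rho>. (v \<bullet> y)\<^sup>2 = 0"
        using AE_supp
      proof eventually_elim
        case (elim y)
        then show ?case using pm[OF elim] v by (auto simp: inner_commute)
      qed
    qed (auto intro!: measurable_continuous_on_F continuous_intros)
    ultimately show False using moments(2) by simp
  qed
qed

section \<open>Moments and the lower bound for the action\<close>

definition moment1 :: "3 \<Rightarrow> real" where
  "moment1 i = (\<integral>y. y $ i \<partial>\<rho>)"

definition moment2 :: "3 \<Rightarrow> 3 \<Rightarrow> real" where
  "moment2 i j = (\<integral>y. y $ i * y $ j \<partial>\<rho>)"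

lemma integrable_component: "integrable \<rho> (\<lambda>y. y $ i)"
  and integrable_component2: "integrable \<rho> (\<lambda>y. y $ i * y $ j)"
  by (intro integrable_continuous_on_F continuous_intros)+

lemma integrable_D: "integrable \<rho> (D \<tau> x)"
proof -
  have "continuous_on F (\<lambda>y. D \<tau> x y)" by (intro continuous_intros)
  then show ?thesis by (rule integrable_continuous_on_F)
qed

lemma integral_D:
  "(\<integral>y. D \<tau> x y \<partial>\<rho>) = 2 * \<tau>\<^sup>2 * (2 - \<tau>\<^sup>2) + 4 * \<tau>\<^sup>2 * (\<Sum>i\<in>UNIV. x $ i * moment1 i)
     + 2 * \<tau> ^ 4 * (\<Sum>i\<in>UNIV. \<Sum>j\<in>UNIV. x $ i * x $ j * moment2 i j)"
proof -
  have "D \<tau> x y = 2 * \<tau>\<^sup>2 * (2 - \<tau>\<^sup>2) + 4 * \<tau>\<^sup>2 * (\<Sum>i\<in>UNIV. x $ i * y $ i)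
     + 2 * \<tau> ^ 4 * (\<Sum>i\<in>UNIV. \<Sum>j\<in>UNIV. (x $ i * x $ j) * (y $ i * y $ j))" for y
    unfolding D_expand inner_vec_def power2_eq_square[of "sum _ _"] sum_product by (simp add: mult_ac)
  then show ?thesis
    using integrable_component integrable_component2 by (simp add: moment1_def moment2_def)
qed

text \<open>On the unit sphere the second moment matrix has trace 1. Splitting off a third of the
  identity therefore lowers its squared norm by exactly \<open>1 / 3\<close>, which leaves the
  trace-free part and yields the constant term.\<close>

lemma integral_integral_D:
  "(\<integral>x. (\<integral>y. D \<tau> x y \<partial>\<rho>) \<partial>\<rho>) = 4 * \<tau>\<^sup>2 - 4 / 3 * \<tau> ^ 4 + 4 * \<tau>\<^sup>2 * (\<Sum>i\<in>UNIV. (moment1 i)\<^sup>2)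
     + 2 * \<tau> ^ 4 * (\<Sum>i\<in>UNIV. \<Sum>j\<in>UNIV. (moment2 i j - (if i = j then 1 / 3 else 0))\<^sup>2)"
proof -
  have tr: "(\<Sum>i\<in>UNIV. moment2 i i) = 1"
  proof -
    have "(\<Sum>i\<in>UNIV. moment2 i i) = (\<integral>y. (\<Sum>i\<in>UNIV. y $ i * y $ i) \<partial>\<rho>)"
      using integrable_component2 by (simp add: moment2_def)
    also have "\<dots> = (\<integral>y. 1 \<partial>\<rho>)"
    proof (intro Bochner_Integration.integral_cong refl)
      fix y assume "y \<in> space \<rho>"
      then have "y \<bullet> y = 1" by (simp add: dot_square_norm)
      then show "(\<Sum>i\<in>UNIV. y $ i * y $ i) = 1" by (simp add: inner_vec_def)
    qed
    finally show ?thesis by simp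
  qed
  have "(\<Sum>i\<in>UNIV. \<Sum>j\<in>UNIV. (moment2 i j - (if i = j then 1 / 3 else 0))\<^sup>2)
      = (\<Sum>i\<in>UNIV. \<Sum>j\<in>UNIV. (moment2 i j)\<^sup>2 + (if i = j then 1 / 9 - 2 / 3 * moment2 i i else 0))"
    by (intro sum.cong refl) (simp add: power2_eq_square algebra_simps)
  also have "\<dots> = (\<Sum>i\<in>UNIV. \<Sum>j\<in>UNIV. (moment2 i j)\<^sup>2) + (\<Sum>i\<in>(UNIV::3 set). 1 / 9) - 2 / 3 * (\<Sum>i\<in>UNIV. moment2 i i)"
    by (simp add: sum.distrib sum_subtractf sum_distrib_left)
  also have "\<dots> = (\<Sum>i\<in>UNIV. \<Sum>j\<in>UNIV. (moment2 i j)\<^sup>2) - 1 / 3"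
    by (simp add: tr)
  finally have sq: "(\<Sum>i\<in>UNIV. \<Sum>j\<in>UNIV. (moment2 i j - (if i = j then 1 / 3 else 0))\<^sup>2)
      = (\<Sum>i\<in>UNIV. \<Sum>j\<in>UNIV. (moment2 i j)\<^sup>2) - 1 / 3" .
  have "(\<integral>x. (\<integral>y. D \<tau> x y \<partial>\<rho>) \<partial>\<rho>) = 2 * \<tau>\<^sup>2 * (2 - \<tau>\<^sup>2) + 4 * \<tau>\<^sup>2 * (\<Sum>i\<in>UNIV. (moment1 i)\<^sup>2)
     + 2 * \<tau> ^ 4 * (\<Sum>i\<in>UNIV. \<Sum>j\<in>UNIV. (moment2 i j)\<^sup>2)"
    unfolding integral_D using integrable_component integrable_component2
    by (simp add: power2_eq_square flip: moment1_def moment2_def)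
  then show ?thesis
    unfolding sq by (simp add: algebra_simps power2_eq_square power4_eq_xxxx)
qed

lemma continuous_on_integral_D: "continuous_on F (\<lambda>x. \<integral>y. D \<tau> x y \<partial>\<rho>)"
  unfolding integral_D by (intro continuous_intros)

lemma integral_integral_D_ge: "4 * \<tau>\<^sup>2 - 4 / 3 * \<tau> ^ 4 \<le> (\<integral>x. (\<integral>y. D \<tau> x y \<partial>\<rho>) \<partial>\<rho>)"
proof -
  have "0 \<le> 4 * \<tau>\<^sup>2 * (\<Sum>i\<in>UNIV. (moment1 i)\<^sup>2)"
    "0 \<le> 2 * \<tau> ^ 4 * (\<Sum>i\<in>UNIV. \<Sum>j\<in>UNIV. (moment2 i j - (if i = j then 1 / 3 else 0))\<^sup>2)"
    by (auto intro!: mult_nonneg_nonneg sum_nonneg)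
  then show ?thesis unfolding integral_integral_D by linarith
qed

text \<open>Equality annihilates both sums of squares, so the first moments vanish and the second
  moment matrix is a third of the identity. The quadratic form in \<open>integral_D\<close> then
  depends on the norm of \<open>x\<close> only.\<close>

lemma integral_D_constant_if_equality:
  assumes "\<tau> \<noteq> 0" and eq: "(\<integral>x. (\<integral>y. D \<tau> x y \<partial>\<rho>) \<partial>\<rho>) = 4 * \<tau>\<^sup>2 - 4 / 3 * \<tau> ^ 4"
  shows "(\<lambda>x. \<integral>y. D \<tau> x y \<partial>\<rho>) constant_on F"
proof -
  let ?A = "\<Sum>i\<in>UNIV. (moment1 i)\<^sup>2"
  let ?B = "\<Sum>i\<in>UNIV. \<Sum>j\<in>UNIV. (moment2 i j - (if i = j then 1 / 3 else 0))\<^sup>2"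
  have "0 \<le> ?A" "0 \<le> ?B" by (auto intro!: sum_nonneg)
  then have "0 \<le> 4 * \<tau>\<^sup>2 * ?A" "0 \<le> 2 * \<tau> ^ 4 * ?B" by (auto intro!: mult_nonneg_nonneg)
  moreover have "4 * \<tau>\<^sup>2 * ?A + 2 * \<tau> ^ 4 * ?B = 0" using eq unfolding integral_integral_D by linarith
  ultimately have "4 * \<tau>\<^sup>2 * ?A = 0" "2 * \<tau> ^ 4 * ?B = 0" by linarith+
  then have "?A = 0" "?B = 0" using assms(1) by auto
  then have m1: "moment1 i = 0" and m2: "moment2 i j = (if i = j then 1 / 3 else 0)" for i j
    by (auto simp: sum_nonneg_eq_0_iff sum_nonneg split: if_splits)
  have "(\<integral>y. D \<tau> x y \<partial>\<rho>) = 2 * \<tau>\<^sup>2 * (2 - \<tau>\<^sup>2) + 2 * \<tau> ^ 4 * (1 / 3)" if "x \<in> F" for x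
  proof -
    have "x \<bullet> x = 1" using that by (simp add: dot_square_norm)
    then have "(\<Sum>i\<in>UNIV. x $ i * x $ i * (1 / 3)) = 1 / 3"
      by (simp add: inner_vec_def flip: sum_divide_distrib)
    then show ?thesis unfolding integral_D m1 m2 by (simp add: if_distrib cong: if_cong)
  qed
  then show ?thesis unfolding constant_on_def by blast
qed

lemma integral_L_minus_D:
  "(\<integral>x. (\<integral>y. L \<tau> x y - D \<tau> x y \<partial>\<rho>) \<partial>\<rho>) = action \<tau> \<rho> - (\<integral>x. (\<integral>y. D \<tau> x y \<partial>\<rho>) \<partial>\<rho>)"
proof -
  have "(\<integral>x. (\<integral>y. L \<tau> x y - D \<tau> x y \<partial>\<rho>) \<partial>\<rho>) = (\<integral>x. potential \<tau> x - (\<integral>y. D \<tau> x y \<partial>\<rho>) \<partial>\<rho>)"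
    using integrable_L integrable_D by (simp add: potential_def)
  also have "\<dots> = (\<integral>x. potential \<tau> x \<partial>\<rho>) - (\<integral>x. (\<integral>y. D \<tau> x y \<partial>\<rho>) \<partial>\<rho>)"
    by (intro Bochner_Integration.integral_diff integrable_continuous_on_F continuous_on_potential continuous_on_integral_D)
  finally show ?thesis by (simp add: integral_potential)
qed

lemma D_le_L: "D \<tau> x y \<le> L \<tau> x y"
  by (simp add: L_def)

lemma action_ge_integral_D: "(\<integral>x. (\<integral>y. D \<tau> x y \<partial>\<rho>) \<partial>\<rho>) \<le> action \<tau> \<rho>"
proof -
  have "0 \<le> (\<integral>x. (\<integral>y. L \<tau> x y - D \<tau> x y \<partial>\<rho>) \<partial>\<rho>)"
    by (intro Bochner_Integration.integral_nonneg) (simp add: D_le_L)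
  then show ?thesis unfolding integral_L_minus_D by simp
qed

lemma action_ge: "4 * \<tau>\<^sup>2 - 4 / 3 * \<tau> ^ 4 \<le> action \<tau> \<rho>"
  using integral_integral_D_ge action_ge_integral_D by (rule order_trans)

text \<open>Both inequalities in the chain from the action over the integral of \<open>D\<close> to
  the constant become equalities. The second gives constancy. The first says that the double
  integral of the nonnegative continuous function \<open>L - D\<close> is 0; applying
  \<open>zero_on_supp_if_integral_zero\<close> in each variable gives \<open>L = D\<close> on the
  support.\<close>

lemma generically_timelike_if_action_eq:
  assumes \<tau>: "\<tau> \<noteq> 0" and eq: "action \<tau> \<rho> = 4 * \<tau>\<^sup>2 - 4 / 3 * \<tau> ^ 4"
  shows "generically_timelike \<tau> \<rho>"
  unfolding generically_timelike_def
proof (intro conjI ballI)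
  have D: "(\<integral>x. (\<integral>y. D \<tau> x y \<partial>\<rho>) \<partial>\<rho>) = 4 * \<tau>\<^sup>2 - 4 / 3 * \<tau> ^ 4"
    using eq action_ge_integral_D[of \<tau>] integral_integral_D_ge[of \<tau>] by linarith
  then show "(\<lambda>x. \<integral>y. D \<tau> x y \<partial>\<rho>) constant_on F"
    by (rule integral_D_constant_if_equality[OF \<tau>])
  fix x y assume x: "x \<in> supp \<rho>" and y: "y \<in> supp \<rho>"
  have "continuous_on F (\<lambda>x. potential \<tau> x - (\<integral>y. D \<tau> x y \<partial>\<rho>))"
    by (intro continuous_on_diff continuous_on_potential continuous_on_integral_D)
  then have "continuous_on F (\<lambda>x. \<integral>y. L \<tau> x y - D \<tau> x y \<partial>\<rho>)"
    using integrable_L integrable_D by (simp add: potential_def)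
  then have "(\<integral>y. L \<tau> x y - D \<tau> x y \<partial>\<rho>) = 0"
    using integral_L_minus_D[of \<tau>] eq D x
    by (intro zero_on_supp_if_integral_zero[of "\<lambda>x. \<integral>y. L \<tau> x y - D \<tau> x y \<partial>\<rho>"]
        Bochner_Integration.integral_nonneg) (auto simp: D_le_L)
  then have "L \<tau> x y - D \<tau> x y = 0"
    using y by (intro zero_on_supp_if_integral_zero[of "\<lambda>y. L \<tau> x y - D \<tau> x y"])
      (auto simp: D_le_L intro!: continuous_intros)
  then show "0 \<le> D \<tau> x y" by (simp add: L_def max_def split: if_splits)
qed

end

section \<open>The octahedron measure as an explicit minimizer\<close>

definition octahedron_vertex :: "3 \<times> bool \<Rightarrow> real ^ 3" where
  "octahedron_vertex p = axis (fst p) (if snd p then 1 else - 1)"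

lemma inner_octahedron_vertex:
  "octahedron_vertex (i, a) \<bullet> octahedron_vertex (j, b) = (if i = j then if a = b then 1 else - 1 else 0)"
  by (auto simp: octahedron_vertex_def inner_axis_axis)

definition octahedron_measure :: "(real ^ 3) measure" where
  "octahedron_measure = distr (measure_pmf (pmf_of_set UNIV)) (restrict_space borel F) octahedron_vertex"

lemma octahedron_measurable:
  "octahedron_vertex \<in> measurable (measure_pmf p) (restrict_space borel F)"
proof -
  have "octahedron_vertex p \<in> F" for p by (auto simp: octahedron_vertex_def norm_eq_sqrt_inner inner_axis_axis)
  then show ?thesis by (simp add: measurable_pmf_measure1 space_restrict_space)
qed

lemma sphere_prob_octahedron: "sphere_prob octahedron_measure"
  unfolding octahedron_measure_def sphere_prob_def sphere_prob_axioms_def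
  by (intro conjI prob_space.prob_space_distr octahedron_measurable measure_pmf.prob_space_axioms) simp

lemma integral_octahedron:
  fixes g :: "real ^ 3 \<Rightarrow> real"
  assumes "g \<in> borel_measurable octahedron_measure"
  shows "(\<integral>x. g x \<partial>octahedron_measure) = (\<Sum>p\<in>UNIV. g (octahedron_vertex p)) / 6"
proof -
  have "(\<integral>x. g x \<partial>octahedron_measure) = (\<integral>p. g (octahedron_vertex p) \<partial>measure_pmf (pmf_of_set UNIV))"
    unfolding octahedron_measure_def
    using assms by (intro integral_distr octahedron_measurable) (simp add: octahedron_measure_def)
  then show ?thesis by (subst (asm) integral_pmf_of_set) auto
qed

text \<open>Each vertex meets itself, its antipode and four orthogonal vertices. The hypothesis
  makes \<open>D\<close> nonnegative at scalar product 0, so all rows of the kernel matrix have the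
  same sum and the potential is constant on the vertices.\<close>

lemma action_octahedron:
  assumes "\<tau>\<^sup>2 \<le> 2"
  shows "action \<tau> octahedron_measure = 4 * \<tau>\<^sup>2 - 4 / 3 * \<tau> ^ 4"
proof -
  interpret sphere_prob octahedron_measure by (rule sphere_prob_octahedron)
  let ?v = octahedron_vertex
  have "2 * \<tau>\<^sup>2 * (2 - \<tau>\<^sup>2) \<ge> 0" using assms by (intro mult_nonneg_nonneg) auto
  then have Lv: "L \<tau> (?v (i, a)) (?v (j, b)) = (if i = j then if a = b then 8 * \<tau>\<^sup>2 else 0 else 2 * \<tau>\<^sup>2 * (2 - \<tau>\<^sup>2))"
    for i j a b by (auto simp: L_def D_def inner_octahedron_vertex)
  have row: "potential \<tau> (?v p) = 4 * \<tau>\<^sup>2 - 4 / 3 * \<tau> ^ 4" for p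
  proof -
    obtain i a where p: "p = (i, a)" by (cases p)
    have "(\<Sum>q\<in>UNIV. L \<tau> (?v p) (?v q)) = (\<Sum>j\<in>UNIV. \<Sum>b\<in>UNIV. L \<tau> (?v p) (?v (j, b)))"
      unfolding sum.cartesian_product UNIV_Times_UNIV by (simp add: case_prod_unfold)
    also have "\<dots> = 8 * \<tau>\<^sup>2 + 4 * (2 * \<tau>\<^sup>2 * (2 - \<tau>\<^sup>2))"
      unfolding p using exhaust_3[of i] by (cases a) (auto simp: Lv UNIV_bool sum_3)
    finally show ?thesis
      unfolding potential_def integral_octahedron[OF borel_measurable_integrable[OF integrable_L]]
      by (simp add: field_simps power2_eq_square power4_eq_xxxx)
  qed
  have "action \<tau> octahedron_measure = (\<integral>x. potential \<tau> x \<partial>octahedron_measure)"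
    by (simp add: integral_potential)
  also have "\<dots> = (\<Sum>p\<in>UNIV. potential \<tau> (?v p)) / 6"
    by (intro integral_octahedron measurable_continuous_on_F continuous_on_potential)
  also have "\<dots> = 4 * \<tau>\<^sup>2 - 4 / 3 * \<tau> ^ 4" by (simp add: row)
  finally show ?thesis .
qed

section \<open>The minimal action and the two parameter regimes\<close>

lemma sphere_prob_if_normalized: "\<rho> \<in> normalized_measures \<Longrightarrow> sphere_prob \<rho>"
  by (simp add: normalized_measures_eq sphere_prob_def sphere_prob_axioms_def)

lemma minimal_action_eq:
  assumes "\<tau>\<^sup>2 \<le> 2"
  shows "minimal_action \<tau> = 4 * \<tau>\<^sup>2 - 4 / 3 * \<tau> ^ 4"
  unfolding minimal_action_def
proof (rule cInf_eq_minimum)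
  interpret sphere_prob octahedron_measure by (rule sphere_prob_octahedron)
  have "octahedron_measure \<in> normalized_measures"
    using sets_rho prob_space_axioms by (simp add: normalized_measures_eq)
  then show "4 * \<tau>\<^sup>2 - 4 / 3 * \<tau> ^ 4 \<in> action \<tau> ` normalized_measures"
    using action_octahedron[OF assms] by (metis imageI)
next
  fix s assume "s \<in> action \<tau> ` normalized_measures"
  then show "4 * \<tau>\<^sup>2 - 4 / 3 * \<tau> ^ 4 \<le> s"
    using sphere_prob.action_ge[OF sphere_prob_if_normalized] by auto
qed

theorem corollary5p1:
  fixes \<tau> :: real
  assumes "\<tau> \<ge> 1"
  shows "(\<tau> \<le> sqrt 2 \<longrightarrow>
            (\<forall>\<rho>. minimizer \<tau> \<rho> \<longrightarrow> generically_timelike \<tau> \<rho>) \<and>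
            minimal_action \<tau> = 4 * \<tau>\<^sup>2 - 4 / 3 * \<tau> ^ 4) \<and>
         (\<tau> > sqrt 2 \<longrightarrow>
            (\<forall>\<rho>. minimizer \<tau> \<rho> \<longrightarrow>
               \<not> generically_timelike \<tau> \<rho> \<and> (top_of_set F) interior_of (supp \<rho>) = {}))"
proof (intro conjI impI allI)
  assume le: "\<tau> \<le> sqrt 2"
  have "\<tau>\<^sup>2 \<le> (sqrt 2)\<^sup>2" using le assms by (intro power_mono) auto
  then have sq: "\<tau>\<^sup>2 \<le> 2" by simp
  then show min: "minimal_action \<tau> = 4 * \<tau>\<^sup>2 - 4 / 3 * \<tau> ^ 4" by (rule minimal_action_eq)
  fix \<rho> assume m: "minimizer \<tau> \<rho>"
  then interpret sphere_prob \<rho> by (intro sphere_prob_if_normalized) (simp add: minimizer_def)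
  show "generically_timelike \<tau> \<rho>"
    using m min assms by (intro generically_timelike_if_action_eq) (auto simp: minimizer_def)
next
  fix \<rho> assume \<tau>: "\<tau> > sqrt 2" and m: "minimizer \<tau> \<rho>"
  then interpret sphere_prob \<rho> by (intro sphere_prob_if_normalized) (simp add: minimizer_def)
  show "\<not> generically_timelike \<tau> \<rho>" by (rule not_generically_timelike[OF \<tau>])
  show "(top_of_set F) interior_of (supp \<rho>) = {}" by (rule interior_supp_empty[OF m \<tau>])
qed

end
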